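(* Let $G$ be a finite abelian group, $\alpha$ a unital partial action of $G$ on a commutative ring $S$, and $S\supseteq R$ a partial Galois extension. Let $f,g\in Z^1(G,\alpha,S)$ be one-dimensional cocycles. Then the $R$-homomorphism $\psi:Q_f\otimes_R Q_g\to Q_{fg}$ defined by $a\otimes b\mapsto ab$ for all $a\in Q_f$, $b\in Q_g$, is an isomorphism.
   Context: Let $k$ be a commutative ring and $S$ a commutative unital $k$-algebra. A unital partial action $\alpha$ of $G$ on $S$ is a family of $k$-algebra isomorphisms $\alpha_g:S_{g^{-1}}\to S_g$ ($g\in G$), where each $S_g$ is an ideal of $S$ having an identity element $1_g$ (so $S_g=S1_g$), such that (i) $S_1=S$ and $\alpha_1=\mathrm{id}_S$; (ii) $\alpha_g(S_{g^{-1}}\cap S_h)=S_g\cap S_{gh}$ for all $g,h\in G$; (iii) $\alpha_g(\alpha_h(x))=\alpha_{gh}(x)$ for all $g,h\in G$, $x\in S_{h^{-1}}\cap S_{(gh)^{-1}}$. Put $S^\alpha=\{a\in S:\alpha_g(a1_{g^{-1}})=a1_g\ \forall g\in G\}$. For a subring $R\subseteq S$ with $1_R=1_S$, $S\supseteq R$ is a partial Galois extension if $R=S^\alpha$ and there are $m\in\mathbb N$ and $x_i,y_i\in S$ ($1\le i\le m$) with $\sum_{i=1}^m x_i\alpha_g(y_i1_{g^{-1}})=\delta_{1,g}$ for all $g\in G$. $Z^1(G,\alpha,S)$ is the abelian group, under pointwise product, of functions $f:G\to S$ with $f(g)\in\mathcal U(S_g)$ for all $g\in G$ and $f(gh)1_g=f(g)\alpha_g(f(h)1_{g^{-1}})$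 for all $g,h\in G$; the identity is $g\mapsto1_g$ and $f^{-1}(g)$ is the inverse of $f(g)$ in $S_g$. Fix $w\in S$ with $\sum_{g\in G}\alpha_g(w1_{g^{-1}})=1$ (such $w$ exists). For $f\in Z^1(G,\alpha,S)$ let $\widehat f\in\operatorname{End}_R(S)$, $\widehat f(x)=\sum_{g\in G}f^{-1}(g)\alpha_g(wx1_{g^{-1}})$, and $Q_f=\operatorname{Im}(\widehat f)$. Equivalently, $Q_f=\{a\in S:\alpha_g(a1_{g^{-1}})=f(g)a\ \forall g\in G\}$. *)

theory Defs
  imports "HOL-Algebra.Algebra"
begin

section \<open>Module homomorphisms and tensor products\<close>

definition mod_hom ::
  "('r, 'c) ring_scheme \<Rightarrow> ('r, 'm, 'd) module_scheme \<Rightarrow> ('r, 'n, 'e) module_scheme \<Rightarrow> ('m \<Rightarrow> 'n) set"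
  where "mod_hom R M N =
    {h \<in> carrier M \<rightarrow> carrier N.
       (\<forall>x\<in>carrier M. \<forall>y\<in>carrier M. h (x \<oplus>\<^bsub>M\<^esub> y) = h x \<oplus>\<^bsub>N\<^esub> h y) \<and>
       (\<forall>r\<in>carrier R. \<forall>x\<in>carrier M. h (r \<odot>\<^bsub>M\<^esub> x) = r \<odot>\<^bsub>N\<^esub> h x)}"

definition mod_iso ::
  "('r, 'c) ring_scheme \<Rightarrow> ('r, 'm, 'd) module_scheme \<Rightarrow> ('r, 'n, 'e) module_scheme \<Rightarrow> ('m \<Rightarrow> 'n) set"
  where "mod_iso R M N = {h \<in> mod_hom R M N. bij_betw h (carrier M) (carrier N)}"

text \<open>
  The tensor product of two modules over a commutative ring \<open>R\<close> is the free abelian group on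
  the set of pairs modulo the usual biadditivity and balancing relations.
\<close>

definition tensor_relations ::
  "('r, 'c) ring_scheme \<Rightarrow> ('r, 'm, 'd) module_scheme \<Rightarrow> ('r, 'n, 'e) module_scheme \<Rightarrow>
     ('m \<times> 'n \<Rightarrow>\<^sub>0 int) set"
  where "tensor_relations R M N =
    {frag_of (x \<oplus>\<^bsub>M\<^esub> x', y) - frag_of (x, y) - frag_of (x', y) | x x' y.
       x \<in> carrier M \<and> x' \<in> carrier M \<and> y \<in> carrier N} \<union>
    {frag_of (x, y \<oplus>\<^bsub>N\<^esub> y') - frag_of (x, y) - frag_of (x, y') | x y y'.
       x \<in> carrier M \<and> y \<in> carrier N \<and> y' \<in> carrier N} \<union>
    {frag_of (r \<odot>\<^bsub>M\<^esub> x, y) - frag_of (x, r \<odot>\<^bsub>N\<^esub> y) | r x y.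
       r \<in> carrier R \<and> x \<in> carrier M \<and> y \<in> carrier N}"

definition tensor_kernel ::
  "('r, 'c) ring_scheme \<Rightarrow> ('r, 'm, 'd) module_scheme \<Rightarrow> ('r, 'n, 'e) module_scheme \<Rightarrow>
     ('m \<times> 'n \<Rightarrow>\<^sub>0 int) set"
  where "tensor_kernel R M N =
    generate (free_Abelian_group (carrier M \<times> carrier N)) (tensor_relations R M N)"

text \<open>
  Scalars act through the endomorphism \<open>(x, y) \<mapsto> (r x, y)\<close> of the free abelian group; taking
  the product set with the kernel turns the image of a coset into a coset again.  The fields
  \<open>mult\<close> and \<open>one\<close>, which the record type of modules inherits from rings, have no meaning for a
  module and are left unspecified.
\<close>

definition tensor_product ::
  "('r, 'c) ring_scheme \<Rightarrow> ('r, 'm, 'd) module_scheme \<Rightarrow> ('r, 'n, 'e) module_scheme \<Rightarrow>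
     ('r, ('m \<times> 'n \<Rightarrow>\<^sub>0 int) set) module"
  where "tensor_product R M N =
    (let F = free_Abelian_group (carrier M \<times> carrier N);
         K = tensor_kernel R M N
     in \<lparr>carrier = carrier (F Mod K), monoid.mult = undefined, one = undefined,
         ring.zero = one (F Mod K), ring.add = monoid.mult (F Mod K),
         smult = (\<lambda>r C. K <#>\<^bsub>F\<^esub> frag_extend (\<lambda>(x, y). frag_of (r \<odot>\<^bsub>M\<^esub> x, y)) ` C)\<rparr>)"

definition pure_tensor ::
  "('r, 'c) ring_scheme \<Rightarrow> ('r, 'm, 'd) module_scheme \<Rightarrow> ('r, 'n, 'e) module_scheme \<Rightarrow>
     'm \<Rightarrow> 'n \<Rightarrow> ('m \<times> 'n \<Rightarrow>\<^sub>0 int) set"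
  where "pure_tensor R M N x y =
    tensor_kernel R M N #>\<^bsub>free_Abelian_group (carrier M \<times> carrier N)\<^esub> frag_of (x, y)"


section \<open>Unital partial actions\<close>

text \<open>
  \<open>D g\<close> is the ideal written \<open>S\<^sub>g\<close> on paper and \<open>e g\<close> its identity element \<open>1\<^sub>g\<close>.
\<close>

abbreviation ideal_ring ::
  "('s, 'c) ring_scheme \<Rightarrow> ('g \<Rightarrow> 's set) \<Rightarrow> ('g \<Rightarrow> 's) \<Rightarrow> 'g \<Rightarrow> ('s, 'c) ring_scheme"
  where "ideal_ring S D e g \<equiv> S\<lparr>carrier := D g, one := e g\<rparr>"

locale unital_partial_action = algebra k S + group G
  for k :: "('k, 'a) ring_scheme"
    and S :: "('k, 's, 'b) module_scheme" (structure)
    and G :: "('g, 'c) monoid_scheme"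
    and D :: "'g \<Rightarrow> 's set"
    and e :: "'g \<Rightarrow> 's"
    and \<alpha> :: "'g \<Rightarrow> 's \<Rightarrow> 's" +
  assumes ideal_D: "g \<in> carrier G \<Longrightarrow> ideal (D g) S"
    and e_in_D: "g \<in> carrier G \<Longrightarrow> e g \<in> D g"
    and e_identity: "\<lbrakk>g \<in> carrier G; x \<in> D g\<rbrakk> \<Longrightarrow> e g \<otimes>\<^bsub>S\<^esub> x = x"
    and \<alpha>_ring_iso:
      "g \<in> carrier G \<Longrightarrow> \<alpha> g \<in> ring_iso (ideal_ring S D e (inv\<^bsub>G\<^esub> g)) (ideal_ring S D e g)"
    and \<alpha>_smult:
      "\<lbrakk>g \<in> carrier G; c \<in> carrier k; x \<in> D (inv\<^bsub>G\<^esub> g)\<rbrakk> \<Longrightarrow> \<alpha> g (c \<odot>\<^bsub>S\<^esub> x) = c \<odot>\<^bsub>S\<^esub> \<alpha> g x"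
    and D_one: "D \<one>\<^bsub>G\<^esub> = carrier S"
    and \<alpha>_one: "x \<in> carrier S \<Longrightarrow> \<alpha> \<one>\<^bsub>G\<^esub> x = x"
    and \<alpha>_image:
      "\<lbrakk>g \<in> carrier G; h \<in> carrier G\<rbrakk> \<Longrightarrow> \<alpha> g ` (D (inv\<^bsub>G\<^esub> g) \<inter> D h) = D g \<inter> D (g \<otimes>\<^bsub>G\<^esub> h)"
    and \<alpha>_comp:
      "\<lbrakk>g \<in> carrier G; h \<in> carrier G; x \<in> D (inv\<^bsub>G\<^esub> h) \<inter> D (inv\<^bsub>G\<^esub> (g \<otimes>\<^bsub>G\<^esub> h))\<rbrakk>
         \<Longrightarrow> \<alpha> g (\<alpha> h x) = \<alpha> (g \<otimes>\<^bsub>G\<^esub> h) x"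

definition invariants ::
  "('s, 'b) ring_scheme \<Rightarrow> ('g, 'c) monoid_scheme \<Rightarrow> ('g \<Rightarrow> 's) \<Rightarrow> ('g \<Rightarrow> 's \<Rightarrow> 's) \<Rightarrow> 's set"
  where "invariants S G e \<alpha> =
    {a \<in> carrier S. \<forall>g\<in>carrier G. \<alpha> g (a \<otimes>\<^bsub>S\<^esub> e (inv\<^bsub>G\<^esub> g)) = a \<otimes>\<^bsub>S\<^esub> e g}"

locale partial_galois_extension = unital_partial_action k S G D e \<alpha>
  for k :: "('k, 'a) ring_scheme"
    and S :: "('k, 's, 'b) module_scheme" (structure)
    and G :: "('g, 'c) monoid_scheme"
    and D :: "'g \<Rightarrow> 's set"
    and e :: "'g \<Rightarrow> 's"
    and \<alpha> :: "'g \<Rightarrow> 's \<Rightarrow> 's"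
    and R :: "'s set" +
  assumes subring_R: "subring R S"
    and R_eq_invariants: "R = invariants S G e \<alpha>"
    and galois_coordinates:
      "\<exists>(m::nat) x y. x \<in> {1..m} \<rightarrow> carrier S \<and> y \<in> {1..m} \<rightarrow> carrier S \<and>
         (\<forall>g\<in>carrier G.
            (\<Oplus>\<^bsub>S\<^esub>i\<in>{1..m}. x i \<otimes>\<^bsub>S\<^esub> \<alpha> g (y i \<otimes>\<^bsub>S\<^esub> e (inv\<^bsub>G\<^esub> g))) =
              (if g = \<one>\<^bsub>G\<^esub> then \<one>\<^bsub>S\<^esub> else \<zero>\<^bsub>S\<^esub>))"


section \<open>One-dimensional cocycles\<close>

text \<open>
  Functions on the group are represented by extensional functions on its carrier, so that
  equality of cocycles is pointwise equality on the carrier.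
\<close>

definition Z1 ::
  "('s, 'b) ring_scheme \<Rightarrow> ('g, 'c) monoid_scheme \<Rightarrow> ('g \<Rightarrow> 's set) \<Rightarrow> ('g \<Rightarrow> 's) \<Rightarrow>
     ('g \<Rightarrow> 's \<Rightarrow> 's) \<Rightarrow> ('g \<Rightarrow> 's) monoid"
  where "Z1 S G D e \<alpha> =
    \<lparr>carrier = {f \<in> carrier G \<rightarrow>\<^sub>E carrier S.
       (\<forall>g\<in>carrier G. f g \<in> Units (ideal_ring S D e g)) \<and>
       (\<forall>g\<in>carrier G. \<forall>h\<in>carrier G.
          f (g \<otimes>\<^bsub>G\<^esub> h) \<otimes>\<^bsub>S\<^esub> e g = f g \<otimes>\<^bsub>S\<^esub> \<alpha> g (f h \<otimes>\<^bsub>S\<^esub> e (inv\<^bsub>G\<^esub> g)))},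
     monoid.mult = (\<lambda>f f'. \<lambda>g\<in>carrier G. f g \<otimes>\<^bsub>S\<^esub> f' g),
     one = (\<lambda>g\<in>carrier G. e g)\<rparr>"

definition twisted_trace ::
  "('s, 'b) ring_scheme \<Rightarrow> ('g, 'c) monoid_scheme \<Rightarrow> ('g \<Rightarrow> 's set) \<Rightarrow> ('g \<Rightarrow> 's) \<Rightarrow>
     ('g \<Rightarrow> 's \<Rightarrow> 's) \<Rightarrow> 's \<Rightarrow> ('g \<Rightarrow> 's) \<Rightarrow> 's \<Rightarrow> 's"
  where "twisted_trace S G D e \<alpha> w f x =
    (\<Oplus>\<^bsub>S\<^esub>g\<in>carrier G.
       inv\<^bsub>ideal_ring S D e g\<^esub> (f g) \<otimes>\<^bsub>S\<^esub> \<alpha> g (w \<otimes>\<^bsub>S\<^esub> x \<otimes>\<^bsub>S\<^esub> e (inv\<^bsub>G\<^esub> g)))"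

text \<open>
  The image of the twisted trace as a module over the subring of invariants, with the operations
  of \<open>S\<close>; its scalar multiplication is the multiplication of \<open>S\<close>, not the action of \<open>k\<close>.
\<close>

definition Q_module ::
  "('s, 'b) ring_scheme \<Rightarrow> ('g, 'c) monoid_scheme \<Rightarrow> ('g \<Rightarrow> 's set) \<Rightarrow> ('g \<Rightarrow> 's) \<Rightarrow>
     ('g \<Rightarrow> 's \<Rightarrow> 's) \<Rightarrow> 's \<Rightarrow> ('g \<Rightarrow> 's) \<Rightarrow> ('s, 's) module"
  where "Q_module S G D e \<alpha> w f =
    \<lparr>carrier = twisted_trace S G D e \<alpha> w f ` carrier S,
     monoid.mult = undefined, one = undefined,
     ring.zero = \<zero>\<^bsub>S\<^esub>, ring.add = ring.add S, smult = monoid.mult S\<rparr>"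

end

theory Submission
  imports Defs
begin

text \<open>
  Write \<open>act g x = \<alpha>\<^sub>g(x 1\<^bsub>g\<inverse>\<^esub>)\<close>, which is defined on all of \<open>S\<close>.  The image \<open>Q\<^sub>f\<close> of the
  twisted trace is the eigenspace \<open>{a. act g a = f(g) a for all g}\<close>
  (\<open>carrier_Q_module\<close>).  In this description \<open>Q\<^sub>f Q\<^sub>g \<subseteq> Q\<^bsub>fg\<^esub>\<close> is immediate, \<open>Q\<^sub>1 = R\<close>, and the
  inverse cocycle \<open>f\<inverse>\<close> gives a module \<open>Q\<^bsub>f\<inverse>\<^esub>\<close> with \<open>Q\<^bsub>f\<inverse>\<^esub> Q\<^sub>f \<subseteq> R\<close>.
  
  The heart of the matter is that \<open>Q\<^sub>f\<close> is invertible: there are \<open>u\<^sub>i \<in> Q\<^sub>f\<close> and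
  \<open>v\<^sub>i \<in> Q\<^bsub>f\<inverse>\<^esub>\<close> with \<open>\<Sum>\<^sub>i u\<^sub>i v\<^sub>i = 1\<close>.  They are obtained from Galois coordinates \<open>x\<^sub>i, y\<^sub>i\<close> as
  twisted traces,
  \<open>u\<^sub>i = \<Sum>\<^sub>g f\<inverse>(g) act g (w x\<^sub>i)\<close> and \<open>v\<^sub>i = \<Sum>\<^sub>h f(h) act h y\<^sub>i\<close>.
  Translating the coordinates by \<open>g\<close> gives
  \<open>\<Sum>\<^sub>i act g x\<^sub>i \<cdot> act h y\<^sub>i = \<delta>\<^bsub>g,h\<^esub> 1\<^sub>g\<close>, so all mixed terms of the product
  cancel and \<open>\<Sum>\<^sub>i u\<^sub>i v\<^sub>i = \<Sum>\<^sub>g act g w = 1\<close> (\<open>trace_dual_basis\<close>).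
  
  Now let \<open>a \<in> Q\<^sub>f\<close> and \<open>b \<in> Q\<^sub>g\<close>.  Since \<open>v\<^sub>i a \<in> R\<close>, these scalars may be moved across the tensor sign:
  \<open>a \<otimes> b = \<Sum>\<^sub>i (v\<^sub>i a) u\<^sub>i \<otimes> b = \<Sum>\<^sub>i u\<^sub>i \<otimes> v\<^sub>i (a b)\<close>.
  The right-hand side depends on \<open>a b\<close> only, so \<open>c \<mapsto> \<Sum>\<^sub>i u\<^sub>i \<otimes> v\<^sub>i c\<close> is a two-sided inverse of
  the multiplication map \<open>Q\<^sub>f \<otimes>\<^sub>R Q\<^sub>g \<rightarrow> Q\<^bsub>fg\<^esub>\<close>.  The part of this argument which only concerns modules is
  \<open>tensor_iso_if_dual_basis\<close>.
\<close>

section \<open>Tensor products of modules\<close>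

locale module_pair = M: module R M + N: module R N
  for R :: "('r, 'c) ring_scheme" and M :: "('r, 'm, 'd) module_scheme"
    and N :: "('r, 'n, 'e) module_scheme"
begin

abbreviation "F \<equiv> free_Abelian_group (carrier M \<times> carrier N)"
abbreviation "K \<equiv> tensor_kernel R M N"
abbreviation "T \<equiv> tensor_product R M N"
abbreviation tensor_class where "tensor_class z \<equiv> K #>\<^bsub>F\<^esub> z"

lemma F_diff: "x \<in> carrier F \<Longrightarrow> y \<in> carrier F \<Longrightarrow> x - y \<in> carrier F"
  using keys_diff[of x y] by auto

lemma F_add: "x \<in> carrier F \<Longrightarrow> y \<in> carrier F \<Longrightarrow> x + y \<in> carrier F"
  using keys_add[of x y] by auto

lemma tensor_relations_closed: "tensor_relations R M N \<subseteq> carrier F"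
  unfolding tensor_relations_def
  by (auto intro!: F_diff simp del: carrier_free_Abelian_group_iff simp: frag_of_in_free_Abelian_group)

text \<open>
  Elements of the tensor product are cosets of \<open>K\<close>, and all computations with them are
  done with representatives in the free abelian group, modulo \<open>K\<close>.  The closure properties of \<open>K\<close>
  are therefore put into the additive notation of that group.
\<close>

lemma tensor_kernel_subgroup: "subgroup K F"
  unfolding tensor_kernel_def
  by (rule group.generate_is_subgroup[OF group_free_Abelian_group tensor_relations_closed])

lemma tensor_kernel_normal: "K \<lhd> F"
  by (rule comm_group.normal_iff_subgroup[THEN iffD2, OF abelian_free_Abelian_group tensor_kernel_subgroup])

lemma tensor_kernel_zero: "0 \<in> K"
  using subgroup.one_closed[OF tensor_kernel_subgroup] by simp

lemma tensor_kernel_in_F: "x \<in> K \<Longrightarrow> x \<in> carrier F"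
  using subgroup.subset[OF tensor_kernel_subgroup] by blast

lemma tensor_kernel_add: "x \<in> K \<Longrightarrow> y \<in> K \<Longrightarrow> x + y \<in> K"
  using subgroup.m_closed[OF tensor_kernel_subgroup] by simp

lemma tensor_kernel_minus: "x \<in> K \<Longrightarrow> - x \<in> K"
  using subgroup.m_inv_closed[OF tensor_kernel_subgroup, of x] tensor_kernel_in_F[of x] by simp

lemma tensor_kernel_diff: "x \<in> K \<Longrightarrow> y \<in> K \<Longrightarrow> x - y \<in> K"
  using tensor_kernel_add[of x "- y"] tensor_kernel_minus[of y] by simp

lemma tensor_kernel_trans: "x - y \<in> K \<Longrightarrow> y - z \<in> K \<Longrightarrow> x - z \<in> K"
  using tensor_kernel_add[of "x - y" "y - z"] by simp

lemma tensor_kernel_sum: "(\<And>i. i \<in> I \<Longrightarrow> x i \<in> K) \<Longrightarrow> sum x I \<in> K"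
  by (induction I rule: infinite_finite_induct) (auto intro: tensor_kernel_add tensor_kernel_zero)

lemma tensor_class_eq_iff:
  assumes "x \<in> carrier F" "y \<in> carrier F"
  shows "tensor_class x = tensor_class y \<longleftrightarrow> x - y \<in> K"
proof
  assume "tensor_class x = tensor_class y"
  moreover have "x \<in> tensor_class x"
    using tensor_kernel_zero by (force simp: r_coset_def)
  ultimately have "x \<in> tensor_class y" by simp
  then show "x - y \<in> K" by (auto simp: r_coset_def)
next
  assume xy: "x - y \<in> K"
  have le: "tensor_class a \<subseteq> tensor_class b" if "a - b \<in> K" for a b
  proof
    fix t assume "t \<in> tensor_class a"
    then obtain h where "h \<in> K" "t = (h + (a - b)) + b"
      by (auto simp: r_coset_def)
    moreover have "h + (a - b) \<in> K"
      using \<open>h \<in> K\<close> that by (rule tensor_kernel_add)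
    ultimately show "t \<in> tensor_class b"
      unfolding r_coset_def mult_free_Abelian_group by blast
  qed
  have "y - x \<in> K" using tensor_kernel_minus[OF xy] by simp
  with xy show "tensor_class x = tensor_class y"
    by (intro equalityI le)
qed

lemma carrier_tensor_product: "carrier T = tensor_class ` carrier F"
  by (simp add: tensor_product_def Let_def carrier_FactGroup)

lemma tensor_add:
  assumes "x \<in> carrier F" "y \<in> carrier F"
  shows "tensor_class x \<oplus>\<^bsub>T\<^esub> tensor_class y = tensor_class (x + y)"
  using normal.rcos_sum[OF tensor_kernel_normal assms] by (simp add: tensor_product_def Let_def)

lemma kernel_additive_left:
  "\<lbrakk>x \<in> carrier M; x' \<in> carrier M; y \<in> carrier N\<rbrakk>
     \<Longrightarrow> frag_of (x \<oplus>\<^bsub>M\<^esub> x', y) - frag_of (x, y) - frag_of (x', y) \<in> K"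
  unfolding tensor_kernel_def tensor_relations_def by (blast intro: generate.incl)

lemma kernel_additive_right:
  "\<lbrakk>x \<in> carrier M; y \<in> carrier N; y' \<in> carrier N\<rbrakk>
     \<Longrightarrow> frag_of (x, y \<oplus>\<^bsub>N\<^esub> y') - frag_of (x, y) - frag_of (x, y') \<in> K"
  unfolding tensor_kernel_def tensor_relations_def by (blast intro: generate.incl)

lemma kernel_balanced:
  "\<lbrakk>r \<in> carrier R; x \<in> carrier M; y \<in> carrier N\<rbrakk>
     \<Longrightarrow> frag_of (r \<odot>\<^bsub>M\<^esub> x, y) - frag_of (x, r \<odot>\<^bsub>N\<^esub> y) \<in> K"
  unfolding tensor_kernel_def tensor_relations_def by (blast intro: generate.incl)

lemma tensor_kernel_least:
  assumes "subgroup H F"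
    and "\<And>x x' y. \<lbrakk>x \<in> carrier M; x' \<in> carrier M; y \<in> carrier N\<rbrakk>
           \<Longrightarrow> frag_of (x \<oplus>\<^bsub>M\<^esub> x', y) - frag_of (x, y) - frag_of (x', y) \<in> H"
    and "\<And>x y y'. \<lbrakk>x \<in> carrier M; y \<in> carrier N; y' \<in> carrier N\<rbrakk>
           \<Longrightarrow> frag_of (x, y \<oplus>\<^bsub>N\<^esub> y') - frag_of (x, y) - frag_of (x, y') \<in> H"
    and "\<And>r x y. \<lbrakk>r \<in> carrier R; x \<in> carrier M; y \<in> carrier N\<rbrakk>
           \<Longrightarrow> frag_of (r \<odot>\<^bsub>M\<^esub> x, y) - frag_of (x, r \<odot>\<^bsub>N\<^esub> y) \<in> H"
  shows "K \<subseteq> H"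
proof -
  have "tensor_relations R M N \<subseteq> H"
    unfolding tensor_relations_def by (safe; rule assms(2-4); assumption)
  then show ?thesis
    unfolding tensor_kernel_def
    using assms(1) by (rule group.generate_subgroup_incl[OF group_free_Abelian_group])
qed

abbreviation scale_left where "scale_left r \<equiv> frag_extend (\<lambda>(x, y). frag_of (r \<odot>\<^bsub>M\<^esub> x, y))"

lemma scale_left_closed:
  assumes "r \<in> carrier R" "z \<in> carrier F"
  shows "scale_left r z \<in> carrier F"
proof -
  have "(\<Union>p\<in>Poly_Mapping.keys z. Poly_Mapping.keys (case p of (x, y) \<Rightarrow> frag_of (r \<odot>\<^bsub>M\<^esub> x, y))) \<subseteq> carrier M \<times> carrier N"
    using assms by auto
  then show ?thesis
    using keys_frag_extend[of "\<lambda>(x, y). frag_of (r \<odot>\<^bsub>M\<^esub> x, y)" z] by simp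
qed

text \<open>
  Scaling the left factor is additive and respects each of the three kinds of generating
  relations, so it acts on the quotient.  Balancing uses commutativity of the scalars:
  \<open>r (s x) = s (r x)\<close>.
\<close>

lemma scale_left_kernel:
  assumes r: "r \<in> carrier R" and "z \<in> K"
  shows "scale_left r z \<in> K"
proof -
  let ?H = "{z \<in> carrier F. scale_left r z \<in> K}"
  have "subgroup ?H F"
  proof (rule subgroup.intro)
    fix x y assume "x \<in> ?H" "y \<in> ?H"
    then show "x \<otimes>\<^bsub>F\<^esub> y \<in> ?H"
      using F_add[of x y] tensor_kernel_add by (simp add: frag_extend_add)
  next
    fix x assume "x \<in> ?H"
    then show "inv\<^bsub>F\<^esub> x \<in> ?H"
      using tensor_kernel_minus by (simp add: frag_extend_minus)
  qed (auto simp: tensor_kernel_zero)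
  then have "K \<subseteq> ?H"
  proof (rule tensor_kernel_least)
    fix x x' y assume xy: "x \<in> carrier M" "x' \<in> carrier M" "y \<in> carrier N"
    then show "frag_of (x \<oplus>\<^bsub>M\<^esub> x', y) - frag_of (x, y) - frag_of (x', y) \<in> ?H"
      using kernel_additive_left[of "r \<odot>\<^bsub>M\<^esub> x" "r \<odot>\<^bsub>M\<^esub> x'" y] r
      by (intro CollectI conjI F_diff) (simp_all add: frag_extend_diff M.smult_r_distr)
  next
    fix x y y' assume xy: "x \<in> carrier M" "y \<in> carrier N" "y' \<in> carrier N"
    then show "frag_of (x, y \<oplus>\<^bsub>N\<^esub> y') - frag_of (x, y) - frag_of (x, y') \<in> ?H"
      using kernel_additive_right[of "r \<odot>\<^bsub>M\<^esub> x" y y'] r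
      by (intro CollectI conjI F_diff) (simp_all add: frag_extend_diff)
  next
    fix s x y assume s: "s \<in> carrier R" and xy: "x \<in> carrier M" "y \<in> carrier N"
    have "r \<odot>\<^bsub>M\<^esub> (s \<odot>\<^bsub>M\<^esub> x) = s \<odot>\<^bsub>M\<^esub> (r \<odot>\<^bsub>M\<^esub> x)"
      using r s xy by (metis M.smult_assoc1 M.R.m_comm)
    then show "frag_of (s \<odot>\<^bsub>M\<^esub> x, y) - frag_of (x, s \<odot>\<^bsub>N\<^esub> y) \<in> ?H"
      using kernel_balanced[of s "r \<odot>\<^bsub>M\<^esub> x" y] r s xy
      by (intro CollectI conjI F_diff) (simp_all add: frag_extend_diff)
  qed
  with assms(2) show ?thesis by blast
qed

text \<open>
  The product set in the definition of the scalar multiplication is a single coset, because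
  scaling maps \<open>K\<close> into \<open>K\<close>.
\<close>

lemma tensor_smult:
  assumes "r \<in> carrier R" "z \<in> carrier F"
  shows "r \<odot>\<^bsub>T\<^esub> tensor_class z = tensor_class (scale_left r z)"
proof -
  have "K <#>\<^bsub>F\<^esub> scale_left r ` tensor_class z = tensor_class (scale_left r z)"
  proof (intro equalityI subsetI)
    fix a assume "a \<in> K <#>\<^bsub>F\<^esub> scale_left r ` tensor_class z"
    then obtain b c where bc: "b \<in> K" "c \<in> K" "a = b + scale_left r (c + z)"
      by (auto simp: set_mult_def r_coset_def)
    then have "a = (b + scale_left r c) + scale_left r z" by (simp add: frag_extend_add)
    moreover have "b + scale_left r c \<in> K"
      using bc scale_left_kernel[OF assms(1)] tensor_kernel_add by simp
    ultimately show "a \<in> tensor_class (scale_left r z)"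
      by (auto simp: r_coset_def)
  next
    fix a assume "a \<in> tensor_class (scale_left r z)"
    then obtain b where "b \<in> K" "a = b + scale_left r (0 + z)"
      by (auto simp: r_coset_def)
    moreover have "0 + z \<in> tensor_class z"
      using tensor_kernel_zero by (force simp: r_coset_def)
    ultimately show "a \<in> K <#>\<^bsub>F\<^esub> scale_left r ` tensor_class z"
      unfolding set_mult_def mult_free_Abelian_group by blast
  qed
  then show ?thesis by (simp add: tensor_product_def Let_def)
qed

lemma pure_tensor_conv: "pure_tensor R M N x y = tensor_class (frag_of (x, y))"
  by (simp add: pure_tensor_def)


lemma pure_tensor_closed:
  "\<lbrakk>a \<in> carrier M; b \<in> carrier N\<rbrakk> \<Longrightarrow> pure_tensor R M N a b \<in> carrier T"
  by (simp add: pure_tensor_conv carrier_tensor_product)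

lemma tensor_add_closed:
  assumes "A \<in> carrier T" "B \<in> carrier T"
  shows "A \<oplus>\<^bsub>T\<^esub> B \<in> carrier T"
  using assms
  by (auto simp: carrier_tensor_product tensor_add F_add simp del: carrier_free_Abelian_group_iff)

lemma tensor_smult_closed:
  assumes "r \<in> carrier R" "A \<in> carrier T"
  shows "r \<odot>\<^bsub>T\<^esub> A \<in> carrier T"
  using assms
  by (auto simp: carrier_tensor_product tensor_smult scale_left_closed simp del: carrier_free_Abelian_group_iff)

section \<open>Homomorphisms on tensor products\<close>

lemma mod_hom_tensor_add:
  assumes "\<psi> \<in> mod_hom R T P" "x \<in> carrier F" "y \<in> carrier F"
  shows "\<psi> (tensor_class (x + y)) = \<psi> (tensor_class x) \<oplus>\<^bsub>P\<^esub> \<psi> (tensor_class y)"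
  using assms unfolding mod_hom_def
  by (simp add: carrier_tensor_product flip: tensor_add del: carrier_free_Abelian_group_iff)

lemma mod_hom_tensor_group_hom:
  assumes "module R P" "\<psi> \<in> mod_hom R T P"
  shows "group_hom F (add_monoid P) (\<lambda>z. \<psi> (tensor_class z))"
proof -
  interpret P: module R P by fact
  have "(\<lambda>z. \<psi> (tensor_class z)) \<in> hom F (add_monoid P)"
    using assms(2) mod_hom_tensor_add[OF assms(2)]
    by (auto simp: hom_def mod_hom_def carrier_tensor_product)
  then show ?thesis
    by (simp add: group_hom_def group_hom_axioms_def P.add.is_group)
qed

lemma group_hom_F_diff:
  assumes "group_hom F (add_monoid P) h" "x \<in> carrier F" "y \<in> carrier F"
  shows "h (x - y) = h x \<ominus>\<^bsub>P\<^esub> h y"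
proof -
  interpret h: group_hom F "add_monoid P" h by fact
  show ?thesis
    using h.hom_mult[of x "- y"] h.hom_inv[of y] assms(2,3)
    by (simp add: a_minus_def a_inv_def)
qed

text \<open>
  The free abelian group is generated by the pairs, so the pure tensors generate the tensor product
  additively.
\<close>

lemma mod_hom_tensor_eqI:
  assumes P: "module R P" and hom: "\<psi> \<in> mod_hom R T P" "\<phi> \<in> mod_hom R T P"
    and eq: "\<And>a b. \<lbrakk>a \<in> carrier M; b \<in> carrier N\<rbrakk>
          \<Longrightarrow> \<psi> (pure_tensor R M N a b) = \<phi> (pure_tensor R M N a b)"
    and C: "C \<in> carrier T"
  shows "\<psi> C = \<phi> C"
proof -
  note hom' = hom[THEN mod_hom_tensor_group_hom[OF P]]
  interpret h1: group_hom F "add_monoid P" "\<lambda>z. \<psi> (tensor_class z)" by (rule hom'(1))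
  interpret h2: group_hom F "add_monoid P" "\<lambda>z. \<phi> (tensor_class z)" by (rule hom'(2))
  obtain z where z: "Poly_Mapping.keys z \<subseteq> carrier M \<times> carrier N" "C = tensor_class z"
    using C by (auto simp: carrier_tensor_product)
  from z(1) have "\<psi> (tensor_class z) = \<phi> (tensor_class z)"
  proof (induction z rule: free_Abelian_group_induct[consumes 1, case_names zero diff gen])
    case zero
    then show ?case using h1.hom_one h2.hom_one by simp
  next
    case (diff x y)
    then show ?case
      using group_hom_F_diff[OF hom'(1), of x y] group_hom_F_diff[OF hom'(2), of x y] by simp
  next
    case (gen p)
    then show ?case using eq by (auto simp: pure_tensor_conv)
  qed
  then show ?thesis using z by simp
qed

end

locale bilinear_pairing = module_pair R M N + P: module R P
  for R :: "('r, 'c) ring_scheme" and M :: "('r, 'm, 'd) module_scheme"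
    and N :: "('r, 'n, 'e) module_scheme" and P :: "('r, 'p, 'f) module_scheme" +
  fixes \<beta> :: "'m \<Rightarrow> 'n \<Rightarrow> 'p"
  assumes pairing_closed: "\<lbrakk>a \<in> carrier M; b \<in> carrier N\<rbrakk> \<Longrightarrow> \<beta> a b \<in> carrier P"
    and pairing_add_left:
      "\<lbrakk>a \<in> carrier M; a' \<in> carrier M; b \<in> carrier N\<rbrakk> \<Longrightarrow> \<beta> (a \<oplus>\<^bsub>M\<^esub> a') b = \<beta> a b \<oplus>\<^bsub>P\<^esub> \<beta> a' b"
    and pairing_add_right:
      "\<lbrakk>a \<in> carrier M; b \<in> carrier N; b' \<in> carrier N\<rbrakk> \<Longrightarrow> \<beta> a (b \<oplus>\<^bsub>N\<^esub> b') = \<beta> a b \<oplus>\<^bsub>P\<^esub> \<beta> a b'"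
    and pairing_smult_left:
      "\<lbrakk>r \<in> carrier R; a \<in> carrier M; b \<in> carrier N\<rbrakk> \<Longrightarrow> \<beta> (r \<odot>\<^bsub>M\<^esub> a) b = r \<odot>\<^bsub>P\<^esub> \<beta> a b"
    and pairing_smult_right:
      "\<lbrakk>r \<in> carrier R; a \<in> carrier M; b \<in> carrier N\<rbrakk> \<Longrightarrow> \<beta> a (r \<odot>\<^bsub>N\<^esub> b) = r \<odot>\<^bsub>P\<^esub> \<beta> a b"
begin

text \<open>
  Bilinearity is exactly what makes the homomorphism extending \<open>\<beta>\<close> to the free abelian group vanish on
  the generators of \<open>K\<close>, so it descends to cosets; compatibility with scalars is checked on pairs.
\<close>

lemma tensor_universal_property:
  obtains \<psi> where "\<psi> \<in> mod_hom R T P"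
    and "\<And>a b. \<lbrakk>a \<in> carrier M; b \<in> carrier N\<rbrakk> \<Longrightarrow> \<psi> (pure_tensor R M N a b) = \<beta> a b"
proof -
  obtain h where h: "h \<in> hom F (add_monoid P)"
    and h_pair: "\<And>p. p \<in> carrier M \<times> carrier N \<Longrightarrow> h (frag_of p) = (case p of (a, b) \<Rightarrow> \<beta> a b)"
    by (rule comm_group.free_Abelian_group_universal[OF P.a_comm_group,
          of "\<lambda>(a, b). \<beta> a b" "carrier M \<times> carrier N"]) (auto simp: pairing_closed)
  interpret h: group_hom F "add_monoid P" h
    using h by (simp add: group_hom_def group_hom_axioms_def P.add.is_group)
  note h_diff = group_hom_F_diff[OF h.group_hom_axioms]
  have cancel: "(p \<oplus>\<^bsub>P\<^esub> q) \<ominus>\<^bsub>P\<^esub> p \<ominus>\<^bsub>P\<^esub> q = \<zero>\<^bsub>P\<^esub>"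
    if "p \<in> carrier P" "q \<in> carrier P" for p q
    using that P.r_neg[of "p \<oplus>\<^bsub>P\<^esub> q"]
    by (simp add: P.minus_eq P.minus_add P.a_assoc)
  have kernel: "K \<subseteq> kernel F (add_monoid P) h"
    using h.subgroup_kernel
  proof (rule tensor_kernel_least)
    fix x x' y assume xy: "x \<in> carrier M" "x' \<in> carrier M" "y \<in> carrier N"
    then show "frag_of (x \<oplus>\<^bsub>M\<^esub> x', y) - frag_of (x, y) - frag_of (x', y) \<in> kernel F (add_monoid P) h"
      unfolding kernel_def
      by (intro CollectI conjI F_diff) 
        (simp_all add: h_diff F_diff h_pair pairing_add_left pairing_closed cancel del: carrier_free_Abelian_group_iff)
  next
    fix x y y' assume xy: "x \<in> carrier M" "y \<in> carrier N" "y' \<in> carrier N"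
    then show "frag_of (x, y \<oplus>\<^bsub>N\<^esub> y') - frag_of (x, y) - frag_of (x, y') \<in> kernel F (add_monoid P) h"
      unfolding kernel_def
      by (intro CollectI conjI F_diff) 
        (simp_all add: h_diff F_diff h_pair pairing_add_right pairing_closed cancel del: carrier_free_Abelian_group_iff)
  next
    fix r x y assume xy: "r \<in> carrier R" "x \<in> carrier M" "y \<in> carrier N"
    then show "frag_of (r \<odot>\<^bsub>M\<^esub> x, y) - frag_of (x, r \<odot>\<^bsub>N\<^esub> y) \<in> kernel F (add_monoid P) h"
      unfolding kernel_def
      by (intro CollectI conjI F_diff) 
        (simp_all add: h_diff F_diff h_pair pairing_smult_left pairing_smult_right pairing_closed P.minus_eq P.r_neg
          del: carrier_free_Abelian_group_iff)
  qed
  have "h x = h y" if "x \<in> carrier F" "y \<in> carrier F" "tensor_class x = tensor_class y" for x y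
  proof -
    have "h (x - y) = \<zero>\<^bsub>P\<^esub>"
      using kernel that tensor_class_eq_iff[of x y] by (auto simp: kernel_def)
    then have "h x \<ominus>\<^bsub>P\<^esub> h y = \<zero>\<^bsub>P\<^esub>" and cl: "h x \<in> carrier P" "h y \<in> carrier P"
      using h_diff[of x y] that h.hom_closed[of x] h.hom_closed[of y] by simp_all
    then have "(h x \<ominus>\<^bsub>P\<^esub> h y) \<oplus>\<^bsub>P\<^esub> h y = h y" by simp
    with cl show ?thesis by (simp add: P.minus_eq P.a_assoc P.l_neg)
  qed
  from FactGroup_universal[OF h tensor_kernel_normal this]
  obtain \<psi> where \<psi>: "\<psi> \<in> hom (F Mod K) (add_monoid P)"
    and \<psi>_class: "\<And>z. z \<in> carrier F \<Longrightarrow> \<psi> (tensor_class z) = h z"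
    by blast
  have scale: "h (scale_left r z) = r \<odot>\<^bsub>P\<^esub> h z" if "z \<in> carrier F" and r: "r \<in> carrier R" for r z
  proof -
    from that(1) have "Poly_Mapping.keys z \<subseteq> carrier M \<times> carrier N" by simp
    then show ?thesis
    proof (induction z rule: free_Abelian_group_induct[consumes 1, case_names zero diff gen])
      case zero
      then show ?case using h.hom_one r by simp
    next
      case (diff x y)
      then have "x \<in> carrier F" "y \<in> carrier F" by simp_all
      then show ?case
        using diff r h.hom_closed[of x] h.hom_closed[of y]
        by (simp add: frag_extend_diff h_diff scale_left_closed P.minus_eq P.smult_r_distr P.smult_r_minus
              del: carrier_free_Abelian_group_iff)
    next
      case (gen p)
      then show ?case using h_pair r by (auto simp: pairing_smult_left)
    qed
  qed
  have "\<psi> \<in> mod_hom R T P"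
    unfolding mod_hom_def
  proof (intro CollectI conjI ballI)
    show "\<psi> \<in> carrier T \<rightarrow> carrier P"
      using h.hom_closed by (auto simp: carrier_tensor_product \<psi>_class)
  next
    fix x y assume "x \<in> carrier T" "y \<in> carrier T"
    then show "\<psi> (x \<oplus>\<^bsub>T\<^esub> y) = \<psi> x \<oplus>\<^bsub>P\<^esub> \<psi> y"
      using \<psi> by (simp add: tensor_product_def Let_def hom_def)
  next
    fix r x assume "r \<in> carrier R" "x \<in> carrier T"
    then show "\<psi> (r \<odot>\<^bsub>T\<^esub> x) = r \<odot>\<^bsub>P\<^esub> \<psi> x"
      by (auto simp: carrier_tensor_product tensor_smult \<psi>_class scale_left_closed scale
            simp del: carrier_free_Abelian_group_iff)
  qed
  moreover have "\<psi> (pure_tensor R M N a b) = \<beta> a b" if "a \<in> carrier M" "b \<in> carrier N" for a b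
    using that by (simp add: pure_tensor_conv \<psi>_class h_pair)
  ultimately show thesis by (rule that)
qed

text \<open>
  Suppose that \<open>M\<close> has a finite dual basis \<open>u\<^sub>i, \<mu>\<^sub>i\<close> and that multiplication of \<open>b\<close> by \<open>\<mu>\<^sub>i(a)\<close>
  factors through the pairing as \<open>\<kappa>\<^sub>i(\<beta>(a,b))\<close>.  Then
  \<open>a \<otimes> b = \<Sum>\<^sub>i \<mu>\<^sub>i(a) u\<^sub>i \<otimes> b = \<Sum>\<^sub>i u\<^sub>i \<otimes> \<kappa>\<^sub>i(\<beta>(a,b))\<close>,
  so the map \<open>\<phi>\<close> sending \<open>c\<close> to \<open>\<Sum>\<^sub>i u\<^sub>i \<otimes> \<kappa>\<^sub>i(c)\<close> is a left inverse of the one induced by \<open>\<beta>\<close>; it is a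
  right inverse because \<open>\<Sum>\<^sub>i \<beta>(u\<^sub>i, \<kappa>\<^sub>i(c)) = c\<close>.
\<close>

lemma tensor_iso_if_dual_basis:
  assumes "finite I"
    and u: "\<And>i. i \<in> I \<Longrightarrow> u i \<in> carrier M"
    and \<mu>: "\<And>i a. \<lbrakk>i \<in> I; a \<in> carrier M\<rbrakk> \<Longrightarrow> \<mu> i a \<in> carrier R"
    and \<kappa>: "\<And>i. i \<in> I \<Longrightarrow> \<kappa> i \<in> mod_hom R P N"
    and expansion: "\<And>a. a \<in> carrier M \<Longrightarrow> (\<Oplus>\<^bsub>M\<^esub>i\<in>I. \<mu> i a \<odot>\<^bsub>M\<^esub> u i) = a"
    and \<kappa>_pairing: "\<And>i a b. \<lbrakk>i \<in> I; a \<in> carrier M; b \<in> carrier N\<rbrakk> \<Longrightarrow> \<kappa> i (\<beta> a b) = \<mu> i a \<odot>\<^bsub>N\<^esub> b"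
    and pairing_\<kappa>: "\<And>c. c \<in> carrier P \<Longrightarrow> (\<Oplus>\<^bsub>P\<^esub>i\<in>I. \<beta> (u i) (\<kappa> i c)) = c"
    and \<psi>: "\<psi> \<in> mod_hom R T P"
    and \<psi>_pure: "\<And>a b. \<lbrakk>a \<in> carrier M; b \<in> carrier N\<rbrakk> \<Longrightarrow> \<psi> (pure_tensor R M N a b) = \<beta> a b"
  shows "\<psi> \<in> mod_iso R T P"
proof -
  define h where "h z = \<psi> (tensor_class z)" for z
  define \<phi> where "\<phi> c = (\<Sum>i\<in>I. frag_of (u i, \<kappa> i c))" for c
  interpret h: group_hom F "add_monoid P" h
    unfolding h_def using mod_hom_tensor_group_hom[OF P.module_axioms \<psi>] .
  have h_closed: "h z \<in> carrier P" if "z \<in> carrier F" for z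
    using h.hom_closed[OF that] by simp
  have h_pair: "h (frag_of (a, b)) = \<beta> a b" if "a \<in> carrier M" "b \<in> carrier N" for a b
    using \<psi>_pure[OF that] by (simp add: h_def pure_tensor_conv)
  have \<kappa>_closed: "\<kappa> i c \<in> carrier N" if "i \<in> I" "c \<in> carrier P" for i c
    using \<kappa>[OF that(1)] that(2) by (auto simp: mod_hom_def)
  have \<kappa>_add: "\<kappa> i (c \<oplus>\<^bsub>P\<^esub> d) = \<kappa> i c \<oplus>\<^bsub>N\<^esub> \<kappa> i d"
    if "i \<in> I" "c \<in> carrier P" "d \<in> carrier P" for i c d
    using \<kappa>[OF that(1)] that(2,3) by (simp add: mod_hom_def)
  have \<phi>_closed: "\<phi> c \<in> carrier F" if "c \<in> carrier P" for c
    unfolding \<phi>_def by (rule sum_closed_free_Abelian_group) (use that u \<kappa>_closed in auto)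
  have h_\<phi>: "h (\<phi> c) = c" if c: "c \<in> carrier P" for c
  proof -
    have "h (\<Sum>i\<in>J. frag_of (u i, \<kappa> i c)) = (\<Oplus>\<^bsub>P\<^esub>i\<in>J. \<beta> (u i) (\<kappa> i c))" if "finite J" "J \<subseteq> I" for J
      using that
    proof (induction J rule: finite_induct)
      case empty
      then show ?case using h.hom_one by simp
    next
      case (insert i J)
      have "(\<Sum>i\<in>J. frag_of (u i, \<kappa> i c)) \<in> carrier F"
        by (rule sum_closed_free_Abelian_group) (use insert c u \<kappa>_closed in auto)
      then have "h (frag_of (u i, \<kappa> i c) + (\<Sum>i\<in>J. frag_of (u i, \<kappa> i c)))
          = \<beta> (u i) (\<kappa> i c) \<oplus>\<^bsub>P\<^esub> h (\<Sum>i\<in>J. frag_of (u i, \<kappa> i c))"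
        using h.hom_mult[of "frag_of (u i, \<kappa> i c)" "\<Sum>i\<in>J. frag_of (u i, \<kappa> i c)"] insert c u \<kappa>_closed
        by (simp add: h_pair)
      also have "\<dots> = (\<Oplus>\<^bsub>P\<^esub>i\<in>insert i J. \<beta> (u i) (\<kappa> i c))"
        using insert c u \<kappa>_closed pairing_closed
        by (subst P.finsum_insert) (auto simp: subset_iff)
      finally show ?case using insert by simp
    qed
    from this[OF \<open>finite I\<close> order_refl] show ?thesis
      using pairing_\<kappa>[OF c] by (simp add: \<phi>_def)
  qed
  have \<phi>_diff: "\<phi> (c \<ominus>\<^bsub>P\<^esub> d) - (\<phi> c - \<phi> d) \<in> K" if c: "c \<in> carrier P" and d: "d \<in> carrier P" for c d
  proof -
    have "frag_of (u i, \<kappa> i c) - frag_of (u i, \<kappa> i (c \<ominus>\<^bsub>P\<^esub> d)) - frag_of (u i, \<kappa> i d) \<in> K" if i: "i \<in> I" for i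
    proof -
      have "(c \<ominus>\<^bsub>P\<^esub> d) \<oplus>\<^bsub>P\<^esub> d = c"
        using c d by (simp add: P.minus_eq P.a_assoc P.l_neg)
      then have "\<kappa> i c = \<kappa> i (c \<ominus>\<^bsub>P\<^esub> d) \<oplus>\<^bsub>N\<^esub> \<kappa> i d"
        using \<kappa>_add[OF i, of "c \<ominus>\<^bsub>P\<^esub> d" d] c d by simp
      then show ?thesis
        using kernel_additive_right[of "u i" "\<kappa> i (c \<ominus>\<^bsub>P\<^esub> d)" "\<kappa> i d"] u[OF i] \<kappa>_closed[OF i] c d by simp
    qed
    then have "(\<Sum>i\<in>I. frag_of (u i, \<kappa> i c) - frag_of (u i, \<kappa> i (c \<ominus>\<^bsub>P\<^esub> d)) - frag_of (u i, \<kappa> i d)) \<in> K"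
      by (rule tensor_kernel_sum)
    then have "- (\<phi> c - \<phi> (c \<ominus>\<^bsub>P\<^esub> d) - \<phi> d) \<in> K"
      by (intro tensor_kernel_minus) (simp add: \<phi>_def sum_subtractf)
    then show ?thesis by (simp add: algebra_simps)
  qed
  \<comment> \<open>It suffices to check \<open>\<phi> \<circ> h = id\<close> modulo \<open>K\<close> on pairs, as both sides are additive modulo \<open>K\<close>.\<close>
  have \<phi>_h: "z - \<phi> (h z) \<in> K" if "z \<in> carrier F" for z
  proof -
    from that have "Poly_Mapping.keys z \<subseteq> carrier M \<times> carrier N" by simp
    then show ?thesis
    proof (induction z rule: free_Abelian_group_induct[consumes 1, case_names zero diff gen])
      case zero
      have "\<phi> \<zero>\<^bsub>P\<^esub> \<in> K"
        using \<phi>_diff[of "\<zero>\<^bsub>P\<^esub>" "\<zero>\<^bsub>P\<^esub>"] by (simp add: P.minus_eq P.r_neg)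
      then show ?case using h.hom_one tensor_kernel_minus by (simp)
    next
      case (diff x y)
      then have xy: "x \<in> carrier F" "y \<in> carrier F" by simp_all
      have "(x - y) - (\<phi> (h x) - \<phi> (h y)) \<in> K"
        using tensor_kernel_diff[OF diff.IH] by (simp add: algebra_simps)
      moreover have "(\<phi> (h x) - \<phi> (h y)) - \<phi> (h x \<ominus>\<^bsub>P\<^esub> h y) \<in> K"
        using tensor_kernel_minus[OF \<phi>_diff[OF h_closed h_closed, OF xy]] by simp
      ultimately have "(x - y) - \<phi> (h x \<ominus>\<^bsub>P\<^esub> h y) \<in> K" by (rule tensor_kernel_trans)
      then show ?case using group_hom_F_diff[OF h.group_hom_axioms xy] by simp
    next
      case (gen p)
      then obtain a b where p: "p = (a, b)" and ab: "a \<in> carrier M" "b \<in> carrier N" by auto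
      have "frag_of (\<Oplus>\<^bsub>M\<^esub>i\<in>J. \<mu> i a \<odot>\<^bsub>M\<^esub> u i, b) - (\<Sum>i\<in>J. frag_of (\<mu> i a \<odot>\<^bsub>M\<^esub> u i, b)) \<in> K"
        if "finite J" "J \<subseteq> I" for J
        using that
      proof (induction J rule: finite_induct)
        case empty
        then show ?case
          using tensor_kernel_minus[OF kernel_additive_left[of "\<zero>\<^bsub>M\<^esub>" "\<zero>\<^bsub>M\<^esub>" b]] ab by simp
      next
        case (insert i J)
        have cl: "\<mu> i a \<odot>\<^bsub>M\<^esub> u i \<in> carrier M" "(\<Oplus>\<^bsub>M\<^esub>i\<in>J. \<mu> i a \<odot>\<^bsub>M\<^esub> u i) \<in> carrier M"
          "(\<lambda>i. \<mu> i a \<odot>\<^bsub>M\<^esub> u i) \<in> J \<rightarrow> carrier M"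
          using insert u \<mu> ab by (auto intro!: M.finsum_closed simp: subset_iff)
        have "(\<Oplus>\<^bsub>M\<^esub>i\<in>insert i J. \<mu> i a \<odot>\<^bsub>M\<^esub> u i) = \<mu> i a \<odot>\<^bsub>M\<^esub> u i \<oplus>\<^bsub>M\<^esub> (\<Oplus>\<^bsub>M\<^esub>i\<in>J. \<mu> i a \<odot>\<^bsub>M\<^esub> u i)"
          using insert cl by (intro M.finsum_insert) auto
        then show ?case
          using tensor_kernel_add[OF kernel_additive_left[OF cl(1,2) ab(2)] insert.IH] insert
          by (simp add: algebra_simps)
      qed
      from this[OF \<open>finite I\<close> order_refl]
      have "frag_of (a, b) - (\<Sum>i\<in>I. frag_of (\<mu> i a \<odot>\<^bsub>M\<^esub> u i, b)) \<in> K"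
        using expansion[OF ab(1)] by simp
      moreover have "(\<Sum>i\<in>I. frag_of (\<mu> i a \<odot>\<^bsub>M\<^esub> u i, b)) - \<phi> (\<beta> a b) \<in> K"
        unfolding \<phi>_def sum_subtractf[symmetric]
        by (rule tensor_kernel_sum) (simp add: \<kappa>_pairing ab kernel_balanced u \<mu>)
      ultimately have "frag_of (a, b) - \<phi> (\<beta> a b) \<in> K" by (rule tensor_kernel_trans)
      then show ?case by (simp add: p h_pair ab)
    qed
  qed
  have "inj_on \<psi> (carrier T)"
  proof (rule inj_onI)
    fix C C' assume "C \<in> carrier T" "C' \<in> carrier T" and eq: "\<psi> C = \<psi> C'"
    then obtain z z' where z: "z \<in> carrier F" "C = tensor_class z" and z': "z' \<in> carrier F" "C' = tensor_class z'"
      by (auto simp: carrier_tensor_product)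
    have "h z = h z'" using eq z z' by (simp add: h_def)
    then have "\<phi> (h z) - z' \<in> K"
      using tensor_kernel_minus[OF \<phi>_h[OF z'(1)]] by simp
    with \<phi>_h[OF z(1)] have "z - z' \<in> K" by (rule tensor_kernel_trans)
    then show "C = C'" using z z' tensor_class_eq_iff by simp
  qed
  moreover have "\<psi> ` carrier T = carrier P"
  proof
    show "\<psi> ` carrier T \<subseteq> carrier P" using \<psi> by (auto simp: mod_hom_def)
    show "carrier P \<subseteq> \<psi> ` carrier T"
    proof
      fix c assume "c \<in> carrier P"
      then have "c = \<psi> (tensor_class (\<phi> c))" "tensor_class (\<phi> c) \<in> carrier T"
        using h_\<phi> \<phi>_closed by (simp_all add: h_def carrier_tensor_product del: carrier_free_Abelian_group_iff)
      then show "c \<in> \<psi> ` carrier T" by blast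
    qed
  qed
  ultimately show ?thesis
    using \<psi> by (simp add: mod_iso_def bij_betw_def)
qed

end

section \<open>A unital partial action as operators on the whole ring\<close>

context unital_partial_action
begin

lemma monoid_S: "monoid S"
  using M_cring by (rule cring.axioms(2)[THEN comm_monoid.axioms(1)])

lemmas S_m_ac = monoid.m_assoc[OF monoid_S] m_comm m_lcomm

text \<open>
  Composing \<open>\<alpha>\<^sub>g\<close> with multiplication by \<open>1\<^bsub>g\<inverse>\<^esub>\<close> gives operators on all of \<open>S\<close>, which need no domain
  conditions.  They are additive and multiplicative; the price is that \<open>1\<close> goes to \<open>1\<^sub>g\<close> and that
  composition holds up to the factor \<open>1\<^sub>g\<close>.
\<close>

definition act :: "'g \<Rightarrow> 's \<Rightarrow> 's"
  where "act g x = \<alpha> g (x \<otimes>\<^bsub>S\<^esub> e (inv\<^bsub>G\<^esub> g))"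

lemma D_subset: "g \<in> carrier G \<Longrightarrow> x \<in> D g \<Longrightarrow> x \<in> carrier S"
  using ideal.Icarr[OF ideal_D] .

lemma e_closed: "g \<in> carrier G \<Longrightarrow> e g \<in> carrier S"
  using D_subset e_in_D by blast

lemma e_idem: "g \<in> carrier G \<Longrightarrow> e g \<otimes>\<^bsub>S\<^esub> e g = e g"
  using e_identity e_in_D by blast

lemma D_mult: "g \<in> carrier G \<Longrightarrow> x \<in> carrier S \<Longrightarrow> y \<in> D g \<Longrightarrow> x \<otimes>\<^bsub>S\<^esub> y \<in> D g"
  using ideal.I_l_closed[OF ideal_D] .

lemma \<alpha>_closed: "g \<in> carrier G \<Longrightarrow> x \<in> D (inv\<^bsub>G\<^esub> g) \<Longrightarrow> \<alpha> g x \<in> D g"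
  using \<alpha>_ring_iso[of g] by (auto simp: ring_iso_def ring_hom_def)

lemma \<alpha>_mult: "g \<in> carrier G \<Longrightarrow> x \<in> D (inv\<^bsub>G\<^esub> g) \<Longrightarrow> y \<in> D (inv\<^bsub>G\<^esub> g)
    \<Longrightarrow> \<alpha> g (x \<otimes>\<^bsub>S\<^esub> y) = \<alpha> g x \<otimes>\<^bsub>S\<^esub> \<alpha> g y"
  using \<alpha>_ring_iso[of g] by (auto simp: ring_iso_def ring_hom_def)

lemma \<alpha>_add: "g \<in> carrier G \<Longrightarrow> x \<in> D (inv\<^bsub>G\<^esub> g) \<Longrightarrow> y \<in> D (inv\<^bsub>G\<^esub> g)
    \<Longrightarrow> \<alpha> g (x \<oplus>\<^bsub>S\<^esub> y) = \<alpha> g x \<oplus>\<^bsub>S\<^esub> \<alpha> g y"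
  using \<alpha>_ring_iso[of g] by (auto simp: ring_iso_def ring_hom_def)

lemma \<alpha>_e: "g \<in> carrier G \<Longrightarrow> \<alpha> g (e (inv\<^bsub>G\<^esub> g)) = e g"
  using \<alpha>_ring_iso[of g] by (auto simp: ring_iso_def ring_hom_def)

lemma act_in_D: "g \<in> carrier G \<Longrightarrow> x \<in> carrier S \<Longrightarrow> act g x \<in> D g"
  unfolding act_def by (intro \<alpha>_closed D_mult e_in_D) auto

lemma act_closed: "g \<in> carrier G \<Longrightarrow> x \<in> carrier S \<Longrightarrow> act g x \<in> carrier S"
  using act_in_D D_subset by blast

lemma e_act: "g \<in> carrier G \<Longrightarrow> x \<in> carrier S \<Longrightarrow> e g \<otimes>\<^bsub>S\<^esub> act g x = act g x"
  using act_in_D e_identity by blast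

lemma act_add: "g \<in> carrier G \<Longrightarrow> x \<in> carrier S \<Longrightarrow> y \<in> carrier S
    \<Longrightarrow> act g (x \<oplus>\<^bsub>S\<^esub> y) = act g x \<oplus>\<^bsub>S\<^esub> act g y"
  unfolding act_def
  by (simp add: l_distr \<alpha>_add D_mult e_in_D e_closed)

lemma act_mult:
  assumes "g \<in> carrier G" "x \<in> carrier S" "y \<in> carrier S"
  shows "act g (x \<otimes>\<^bsub>S\<^esub> y) = act g x \<otimes>\<^bsub>S\<^esub> act g y"
proof -
  let ?e = "e (inv\<^bsub>G\<^esub> g)"
  have "?e \<in> carrier S" "?e \<otimes>\<^bsub>S\<^esub> ?e = ?e"
    using assms e_closed e_idem by auto
  then have "(x \<otimes>\<^bsub>S\<^esub> y) \<otimes>\<^bsub>S\<^esub> ?e = (x \<otimes>\<^bsub>S\<^esub> y) \<otimes>\<^bsub>S\<^esub> (?e \<otimes>\<^bsub>S\<^esub> ?e)" by simp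
  also have "\<dots> = (x \<otimes>\<^bsub>S\<^esub> ?e) \<otimes>\<^bsub>S\<^esub> (y \<otimes>\<^bsub>S\<^esub> ?e)"
    using assms \<open>?e \<in> carrier S\<close> by (simp add: S_m_ac)
  finally have "(x \<otimes>\<^bsub>S\<^esub> y) \<otimes>\<^bsub>S\<^esub> ?e = (x \<otimes>\<^bsub>S\<^esub> ?e) \<otimes>\<^bsub>S\<^esub> (y \<otimes>\<^bsub>S\<^esub> ?e)" .
  then show ?thesis
    unfolding act_def using assms by (simp add: \<alpha>_mult D_mult e_in_D)
qed

lemma act_one: "g \<in> carrier G \<Longrightarrow> act g \<one>\<^bsub>S\<^esub> = e g"
  by (simp add: act_def \<alpha>_e monoid.l_one[OF monoid_S] e_closed)

lemma act_zero: "g \<in> carrier G \<Longrightarrow> act g \<zero>\<^bsub>S\<^esub> = \<zero>\<^bsub>S\<^esub>"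
  using act_add[of g "\<zero>\<^bsub>S\<^esub>" "\<zero>\<^bsub>S\<^esub>"] act_closed[of g "\<zero>\<^bsub>S\<^esub>"] by simp

lemma act_finsum:
  assumes "g \<in> carrier G" "finite I" "x \<in> I \<rightarrow> carrier S"
  shows "act g (\<Oplus>\<^bsub>S\<^esub>i\<in>I. x i) = (\<Oplus>\<^bsub>S\<^esub>i\<in>I. act g (x i))"
  using assms(2,3)
proof (induction I rule: finite_induct)
  case empty
  then show ?case by (simp add: act_zero assms(1))
next
  case (insert i I)
  then have "x i \<in> carrier S" "x \<in> I \<rightarrow> carrier S" by auto
  moreover from this have "(\<lambda>i. act g (x i)) \<in> I \<rightarrow> carrier S" "act g (x i) \<in> carrier S"
    using act_closed[OF assms(1)] by auto
  ultimately show ?case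
    using insert by (simp add: act_add assms(1))
qed

text \<open>
  \<open>1\<^bsub>g\<inverse>\<^esub> 1\<^sub>h\<close> is the identity element of the ideal \<open>S\<^bsub>g\<inverse>\<^esub> \<inter> S\<^sub>h\<close>, which \<open>\<alpha>\<^sub>g\<close> maps onto
  \<open>S\<^sub>g \<inter> S\<^bsub>gh\<^esub>\<close>; hence it goes to the identity element \<open>1\<^sub>g 1\<^bsub>gh\<^esub>\<close> of the latter.
\<close>

lemma act_e:
  assumes g: "g \<in> carrier G" and h: "h \<in> carrier G"
  shows "act g (e h) = e g \<otimes>\<^bsub>S\<^esub> e (g \<otimes>\<^bsub>G\<^esub> h)"
proof -
  let ?p = "e (inv\<^bsub>G\<^esub> g) \<otimes>\<^bsub>S\<^esub> e h" and ?q = "e g \<otimes>\<^bsub>S\<^esub> e (g \<otimes>\<^bsub>G\<^esub> h)"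
  note cl = e_closed[OF g] e_closed[OF h] e_closed[of "inv\<^bsub>G\<^esub> g"] e_closed[of "g \<otimes>\<^bsub>G\<^esub> h"]
  have p: "?p \<in> D (inv\<^bsub>G\<^esub> g) \<inter> D h"
    using g h cl D_mult[of "inv\<^bsub>G\<^esub> g" "e h" "e (inv\<^bsub>G\<^esub> g)"] D_mult[of h "e (inv\<^bsub>G\<^esub> g)" "e h"] e_in_D
    by (simp add: m_comm)
  have q: "?q \<in> D g \<inter> D (g \<otimes>\<^bsub>G\<^esub> h)"
    using g h cl D_mult[of g "e (g \<otimes>\<^bsub>G\<^esub> h)" "e g"] D_mult[of "g \<otimes>\<^bsub>G\<^esub> h" "e g" "e (g \<otimes>\<^bsub>G\<^esub> h)"] e_in_D
    by (simp add: m_comm)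
  have \<alpha>p: "\<alpha> g ?p \<in> D g \<inter> D (g \<otimes>\<^bsub>G\<^esub> h)"
    using \<alpha>_image[OF g h] p by blast
  then have \<alpha>p_closed: "\<alpha> g ?p \<in> carrier S" using D_subset[OF g] by blast
  have "?q \<in> \<alpha> g ` (D (inv\<^bsub>G\<^esub> g) \<inter> D h)"
    using q by (simp only: \<alpha>_image[OF g h])
  then obtain y where y: "y \<in> D (inv\<^bsub>G\<^esub> g) \<inter> D h" "\<alpha> g y = ?q"
    by (elim imageE) simp
  have "y \<in> carrier S" using y D_subset[OF h] by blast
  moreover have "e (inv\<^bsub>G\<^esub> g) \<otimes>\<^bsub>S\<^esub> y = y" "e h \<otimes>\<^bsub>S\<^esub> y = y"
    using y g h by (simp_all add: e_identity)
  ultimately have "?p \<otimes>\<^bsub>S\<^esub> y = y"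
    using g h cl by (simp add: S_m_ac(1))
  then have "\<alpha> g ?p \<otimes>\<^bsub>S\<^esub> ?q = ?q"
    using \<alpha>_mult[OF g, of ?p y] p y by simp
  moreover have "?q \<otimes>\<^bsub>S\<^esub> \<alpha> g ?p = \<alpha> g ?p"
  proof -
    have "e g \<otimes>\<^bsub>S\<^esub> \<alpha> g ?p = \<alpha> g ?p" "e (g \<otimes>\<^bsub>G\<^esub> h) \<otimes>\<^bsub>S\<^esub> \<alpha> g ?p = \<alpha> g ?p"
      using \<alpha>p g h by (simp_all add: e_identity)
    then show ?thesis using \<alpha>p_closed g h cl by (simp add: S_m_ac(1))
  qed
  ultimately have "\<alpha> g ?p = ?q"
    using \<alpha>p_closed g h cl m_comm[of "\<alpha> g ?p" ?q] by simp
  then show ?thesis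
    using g h cl m_comm[of "e h" "e (inv\<^bsub>G\<^esub> g)"] by (simp add: act_def)
qed

text \<open>
  The composition law of \<open>\<alpha>\<close> applies only on \<open>S\<^bsub>h\<inverse>\<^esub> \<inter> S\<^bsub>(gh)\<inverse>\<^esub>\<close>.  The factor \<open>1\<^bsub>g\<inverse>\<^esub>\<close> in the outer
  operator is, up to the factor \<open>1\<^sub>h\<close>, the image of \<open>1\<^bsub>(gh)\<inverse>\<^esub>\<close> under the inner one, and so it can be
  moved inside, where it brings the argument into that intersection.
\<close>

lemma act_act:
  assumes g: "g \<in> carrier G" and h: "h \<in> carrier G" and x: "x \<in> carrier S"
  shows "act g (act h x) = e g \<otimes>\<^bsub>S\<^esub> act (g \<otimes>\<^bsub>G\<^esub> h) x"
proof -
  let ?gh = "g \<otimes>\<^bsub>G\<^esub> h"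
  define y where "y = x \<otimes>\<^bsub>S\<^esub> e (inv\<^bsub>G\<^esub> ?gh) \<otimes>\<^bsub>S\<^esub> e (inv\<^bsub>G\<^esub> h)"
  note cl = e_closed[OF g] e_closed[OF h] e_closed[of "inv\<^bsub>G\<^esub> g"] e_closed[of "inv\<^bsub>G\<^esub> h"]
    e_closed[of "?gh"] e_closed[of "inv\<^bsub>G\<^esub> ?gh"] act_closed[OF h x] act_closed[of ?gh x]
  have y_alt: "y = x \<otimes>\<^bsub>S\<^esub> e (inv\<^bsub>G\<^esub> h) \<otimes>\<^bsub>S\<^esub> e (inv\<^bsub>G\<^esub> ?gh)"
    using g h x cl by (simp add: y_def S_m_ac)
  have y: "y \<in> D (inv\<^bsub>G\<^esub> h) \<inter> D (inv\<^bsub>G\<^esub> ?gh)"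
  proof
    show "y \<in> D (inv\<^bsub>G\<^esub> h)"
      unfolding y_def using g h x cl by (intro D_mult e_in_D) auto
    show "y \<in> D (inv\<^bsub>G\<^esub> ?gh)"
      unfolding y_alt using g h x cl by (intro D_mult e_in_D) auto
  qed
  have "h \<otimes>\<^bsub>G\<^esub> inv\<^bsub>G\<^esub> ?gh = inv\<^bsub>G\<^esub> g" 
    using g h by (simp add: inv_mult_group flip: m_assoc)
  then have "act h (x \<otimes>\<^bsub>S\<^esub> e (inv\<^bsub>G\<^esub> ?gh)) = act h x \<otimes>\<^bsub>S\<^esub> (e h \<otimes>\<^bsub>S\<^esub> e (inv\<^bsub>G\<^esub> g))"
    using g h x cl by (simp add: act_mult act_e)
  also have "\<dots> = (e h \<otimes>\<^bsub>S\<^esub> act h x) \<otimes>\<^bsub>S\<^esub> e (inv\<^bsub>G\<^esub> g)"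
    using g cl by (simp add: S_m_ac)
  finally have "act g (act h x) = \<alpha> g (\<alpha> h y)"
    using e_act[OF h x] by (simp add: act_def y_def)
  also have "\<dots> = \<alpha> ?gh y" by (rule \<alpha>_comp[OF g h y])
  also have "\<dots> = act ?gh (x \<otimes>\<^bsub>S\<^esub> e (inv\<^bsub>G\<^esub> h))" by (simp add: act_def y_alt)
  also have "\<dots> = act ?gh x \<otimes>\<^bsub>S\<^esub> (e ?gh \<otimes>\<^bsub>S\<^esub> e g)"
    using g h x cl by (simp add: act_mult act_e m_assoc)
  also have "\<dots> = e g \<otimes>\<^bsub>S\<^esub> (e ?gh \<otimes>\<^bsub>S\<^esub> act ?gh x)"
    using g h x cl by (simp add: S_m_ac)
  finally show ?thesis using e_act[of ?gh x] g h x by simp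
qed

section \<open>Cocycles and their inverses\<close>

text \<open>
  A cocycle together with its pointwise inverse in the ideals \<open>S\<^sub>g\<close>.  The cocycle identity is solved for
  \<open>act g (\<phi> h)\<close>, which makes the notion visibly symmetric in \<open>\<phi>\<close> and \<open>\<psi>\<close> and turns the
  identity into a rewrite rule.
\<close>

definition inverse_cocycles :: "('g \<Rightarrow> 's) \<Rightarrow> ('g \<Rightarrow> 's) \<Rightarrow> bool"
  where "inverse_cocycles \<phi> \<psi> \<longleftrightarrow>
    (\<forall>g\<in>carrier G. \<phi> g \<in> D g \<and> \<psi> g \<in> D g \<and> \<phi> g \<otimes>\<^bsub>S\<^esub> \<psi> g = e g) \<and>
    (\<forall>g\<in>carrier G. \<forall>h\<in>carrier G.
       act g (\<phi> h) = \<psi> g \<otimes>\<^bsub>S\<^esub> \<phi> (g \<otimes>\<^bsub>G\<^esub> h) \<and> act g (\<psi> h) = \<phi> g \<otimes>\<^bsub>S\<^esub> \<psi> (g \<otimes>\<^bsub>G\<^esub> h))"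

lemma inverse_cocyclesD:
  assumes "inverse_cocycles \<phi> \<psi>" "g \<in> carrier G"
  shows "\<phi> g \<in> carrier S" "\<psi> g \<in> carrier S" "\<phi> g \<in> D g" "\<psi> g \<in> D g" "\<phi> g \<otimes>\<^bsub>S\<^esub> \<psi> g = e g"
    "e g \<otimes>\<^bsub>S\<^esub> \<phi> g = \<phi> g" "e g \<otimes>\<^bsub>S\<^esub> \<psi> g = \<psi> g"
proof -
  show D: "\<phi> g \<in> D g" "\<psi> g \<in> D g" "\<phi> g \<otimes>\<^bsub>S\<^esub> \<psi> g = e g"
    using assms by (simp_all add: inverse_cocycles_def)
  show "\<phi> g \<in> carrier S" "\<psi> g \<in> carrier S" "e g \<otimes>\<^bsub>S\<^esub> \<phi> g = \<phi> g" "e g \<otimes>\<^bsub>S\<^esub> \<psi> g = \<psi> g"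
    using D_subset[OF assms(2)] e_identity[OF assms(2)] D by blast+
qed

lemma inverse_cocycles_act:
  assumes "inverse_cocycles \<phi> \<psi>" "g \<in> carrier G" "h \<in> carrier G"
  shows "act g (\<phi> h) = \<psi> g \<otimes>\<^bsub>S\<^esub> \<phi> (g \<otimes>\<^bsub>G\<^esub> h)" "act g (\<psi> h) = \<phi> g \<otimes>\<^bsub>S\<^esub> \<psi> (g \<otimes>\<^bsub>G\<^esub> h)"
  using assms by (auto simp: inverse_cocycles_def)

lemma inverse_cocycles_sym:
  assumes "inverse_cocycles \<phi> \<psi>"
  shows "inverse_cocycles \<psi> \<phi>"
  unfolding inverse_cocycles_def
  using inverse_cocyclesD[OF assms] inverse_cocycles_act[OF assms] by (simp add: m_comm)

lemma inverse_cocycles_mult: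
  assumes "inverse_cocycles \<phi> \<psi>" "inverse_cocycles \<phi>' \<psi>'"
  shows "inverse_cocycles (\<lambda>g\<in>carrier G. \<phi> g \<otimes>\<^bsub>S\<^esub> \<phi>' g) (\<lambda>g. \<psi> g \<otimes>\<^bsub>S\<^esub> \<psi>' g)"
proof -
  note D = inverse_cocyclesD[OF assms(1)] inverse_cocyclesD[OF assms(2)]
  have "\<phi> g \<otimes>\<^bsub>S\<^esub> \<phi>' g \<otimes>\<^bsub>S\<^esub> (\<psi> g \<otimes>\<^bsub>S\<^esub> \<psi>' g) = e g" if "g \<in> carrier G" for g
  proof -
    have "\<phi> g \<otimes>\<^bsub>S\<^esub> \<phi>' g \<otimes>\<^bsub>S\<^esub> (\<psi> g \<otimes>\<^bsub>S\<^esub> \<psi>' g) = (\<phi> g \<otimes>\<^bsub>S\<^esub> \<psi> g) \<otimes>\<^bsub>S\<^esub> (\<phi>' g \<otimes>\<^bsub>S\<^esub> \<psi>' g)"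
      using D(1,2,8,9)[OF that] by (simp add: S_m_ac)
    then show ?thesis using D(5,12)[OF that] e_idem[OF that] by simp
  qed
  then show ?thesis
    unfolding inverse_cocycles_def
  proof (intro conjI ballI)
    fix g h assume g: "g \<in> carrier G" and h: "h \<in> carrier G"
    then have gh: "g \<otimes>\<^bsub>G\<^esub> h \<in> carrier G" by simp
    note cl = D(1,2,8,9)[OF g] D(1,2,8,9)[OF h] D(1,2,8,9)[OF gh]
    show "act g ((\<lambda>g\<in>carrier G. \<phi> g \<otimes>\<^bsub>S\<^esub> \<phi>' g) h) =
        \<psi> g \<otimes>\<^bsub>S\<^esub> \<psi>' g \<otimes>\<^bsub>S\<^esub> (\<lambda>g\<in>carrier G. \<phi> g \<otimes>\<^bsub>S\<^esub> \<phi>' g) (g \<otimes>\<^bsub>G\<^esub> h)"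
      using g h cl inverse_cocycles_act(1)[OF assms(1) g h] inverse_cocycles_act(1)[OF assms(2) g h]
      by (simp add: act_mult S_m_ac)
    show "act g (\<psi> h \<otimes>\<^bsub>S\<^esub> \<psi>' h) =
        (\<lambda>g\<in>carrier G. \<phi> g \<otimes>\<^bsub>S\<^esub> \<phi>' g) g \<otimes>\<^bsub>S\<^esub> (\<psi> (g \<otimes>\<^bsub>G\<^esub> h) \<otimes>\<^bsub>S\<^esub> \<psi>' (g \<otimes>\<^bsub>G\<^esub> h))"
      using g h cl inverse_cocycles_act(2)[OF assms(1) g h] inverse_cocycles_act(2)[OF assms(2) g h]
      by (simp add: act_mult S_m_ac)
  qed (simp_all add: D D_mult)
qed

text \<open>
  The pointwise inverses of a cocycle satisfy the cocycle identity as well, so membership in \<open>Z1\<close>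
  amounts to the existence of an inverse cocycle.
\<close>

lemma Z1_iff_inverse_cocycles:
  "f \<in> carrier (Z1 S G D e \<alpha>) \<longleftrightarrow> f \<in> extensional (carrier G) \<and> (\<exists>\<psi>. inverse_cocycles f \<psi>)"
proof (intro iffI conjI)
  assume f: "f \<in> carrier (Z1 S G D e \<alpha>)"
  then show "f \<in> extensional (carrier G)" by (simp add: Z1_def PiE_def)
  have "\<forall>g\<in>carrier G. \<exists>y. f g \<in> D g \<and> y \<in> D g \<and> f g \<otimes>\<^bsub>S\<^esub> y = e g"
    using f by (auto simp: Z1_def Units_def)
  then obtain \<psi> where \<psi>: "\<forall>g\<in>carrier G. f g \<in> D g \<and> \<psi> g \<in> D g \<and> f g \<otimes>\<^bsub>S\<^esub> \<psi> g = e g"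
    using bchoice[of "carrier G" "\<lambda>g y. f g \<in> D g \<and> y \<in> D g \<and> f g \<otimes>\<^bsub>S\<^esub> y = e g"] by blast
  have cocycle: "f (g \<otimes>\<^bsub>G\<^esub> h) \<otimes>\<^bsub>S\<^esub> e g = f g \<otimes>\<^bsub>S\<^esub> act g (f h)"
    if "g \<in> carrier G" "h \<in> carrier G" for g h
    using f that by (simp add: Z1_def act_def)
  have "act g (f h) = \<psi> g \<otimes>\<^bsub>S\<^esub> f (g \<otimes>\<^bsub>G\<^esub> h) \<and> act g (\<psi> h) = f g \<otimes>\<^bsub>S\<^esub> \<psi> (g \<otimes>\<^bsub>G\<^esub> h)"
    if g: "g \<in> carrier G" and h: "h \<in> carrier G" for g h
  proof
    have gh: "g \<otimes>\<^bsub>G\<^esub> h \<in> carrier G" using g h by simp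
    have cl: "f g \<in> carrier S" "\<psi> g \<in> carrier S" "f h \<in> carrier S" "\<psi> h \<in> carrier S"
      "f (g \<otimes>\<^bsub>G\<^esub> h) \<in> carrier S" "\<psi> (g \<otimes>\<^bsub>G\<^esub> h) \<in> carrier S"
      "e g \<in> carrier S" "e h \<in> carrier S" "e (g \<otimes>\<^bsub>G\<^esub> h) \<in> carrier S"
      "act g (f h) \<in> carrier S" "act g (\<psi> h) \<in> carrier S"
      using \<psi> g h gh D_subset e_closed act_closed by blast+
    have "\<psi> g \<otimes>\<^bsub>S\<^esub> f (g \<otimes>\<^bsub>G\<^esub> h) = (e g \<otimes>\<^bsub>S\<^esub> \<psi> g) \<otimes>\<^bsub>S\<^esub> f (g \<otimes>\<^bsub>G\<^esub> h)"
      using \<psi> g e_identity by simp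
    also have "\<dots> = \<psi> g \<otimes>\<^bsub>S\<^esub> (f (g \<otimes>\<^bsub>G\<^esub> h) \<otimes>\<^bsub>S\<^esub> e g)"
      using cl by (simp add: S_m_ac)
    also have "\<dots> = (f g \<otimes>\<^bsub>S\<^esub> \<psi> g) \<otimes>\<^bsub>S\<^esub> act g (f h)"
      unfolding cocycle[OF g h] using cl by (simp add: S_m_ac)
    finally show eq: "act g (f h) = \<psi> g \<otimes>\<^bsub>S\<^esub> f (g \<otimes>\<^bsub>G\<^esub> h)"
      using \<psi> g cl h e_act by simp
    \<comment> \<open>\<open>act g (\<psi> h)\<close> lies in the ideal generated by \<open>1\<^sub>g 1\<^bsub>gh\<^esub>\<close>, in which it is inverse to
      \<open>act g (f h) = \<psi>(g) f(gh)\<close>; so is \<open>f(g) \<psi>(gh)\<close>, and inverses are unique.\<close>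
    have X: "(e g \<otimes>\<^bsub>S\<^esub> e (g \<otimes>\<^bsub>G\<^esub> h)) \<otimes>\<^bsub>S\<^esub> act g (\<psi> h) = act g (\<psi> h)"
      using act_mult[of g "e h" "\<psi> h"] act_e[OF g h] e_identity[of h "\<psi> h"] \<psi> g h cl by simp
    have fX: "(\<psi> g \<otimes>\<^bsub>S\<^esub> f (g \<otimes>\<^bsub>G\<^esub> h)) \<otimes>\<^bsub>S\<^esub> act g (\<psi> h) = e g \<otimes>\<^bsub>S\<^esub> e (g \<otimes>\<^bsub>G\<^esub> h)"
      using act_mult[of g "f h" "\<psi> h"] act_e[OF g h] eq \<psi> g h cl by simp
    have "f g \<otimes>\<^bsub>S\<^esub> \<psi> (g \<otimes>\<^bsub>G\<^esub> h) = (e g \<otimes>\<^bsub>S\<^esub> f g) \<otimes>\<^bsub>S\<^esub> (e (g \<otimes>\<^bsub>G\<^esub> h) \<otimes>\<^bsub>S\<^esub> \<psi> (g \<otimes>\<^bsub>G\<^esub> h))"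
      using \<psi> g gh e_identity by simp
    also have "\<dots> = (f g \<otimes>\<^bsub>S\<^esub> \<psi> (g \<otimes>\<^bsub>G\<^esub> h)) \<otimes>\<^bsub>S\<^esub> (e g \<otimes>\<^bsub>S\<^esub> e (g \<otimes>\<^bsub>G\<^esub> h))"
      using cl by (simp add: S_m_ac)
    also have "\<dots> = (f g \<otimes>\<^bsub>S\<^esub> \<psi> g) \<otimes>\<^bsub>S\<^esub> (f (g \<otimes>\<^bsub>G\<^esub> h) \<otimes>\<^bsub>S\<^esub> \<psi> (g \<otimes>\<^bsub>G\<^esub> h)) \<otimes>\<^bsub>S\<^esub> act g (\<psi> h)"
      unfolding fX[symmetric] using cl by (simp add: S_m_ac)
    also have "\<dots> = act g (\<psi> h)"
      using \<psi> g gh X by simp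
    finally show "act g (\<psi> h) = f g \<otimes>\<^bsub>S\<^esub> \<psi> (g \<otimes>\<^bsub>G\<^esub> h)" by simp
  qed
  with \<psi> have "inverse_cocycles f \<psi>" by (auto simp: inverse_cocycles_def)
  then show "\<exists>\<psi>. inverse_cocycles f \<psi>" by blast
next
  assume "f \<in> extensional (carrier G) \<and> (\<exists>\<psi>. inverse_cocycles f \<psi>)"
  then obtain \<psi> where ext: "f \<in> extensional (carrier G)" and \<psi>: "inverse_cocycles f \<psi>" by blast
  note D = inverse_cocyclesD[OF \<psi>]
  have "f g \<in> Units (ideal_ring S D e g)" if "g \<in> carrier G" for g
    using D[OF that] by (auto simp: Units_def m_comm intro!: bexI[of _ "\<psi> g"])
  moreover have "f (g \<otimes>\<^bsub>G\<^esub> h) \<otimes>\<^bsub>S\<^esub> e g = f g \<otimes>\<^bsub>S\<^esub> act g (f h)"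
    if g: "g \<in> carrier G" and h: "h \<in> carrier G" for g h
  proof -
    have "f g \<otimes>\<^bsub>S\<^esub> act g (f h) = (f g \<otimes>\<^bsub>S\<^esub> \<psi> g) \<otimes>\<^bsub>S\<^esub> f (g \<otimes>\<^bsub>G\<^esub> h)"
      using inverse_cocycles_act(1)[OF \<psi> g h] D(1,2)[OF g] D(1)[of "g \<otimes>\<^bsub>G\<^esub> h"] g h
      by (simp add: S_m_ac)
    then show ?thesis
      using D(5)[OF g] D(1)[of "g \<otimes>\<^bsub>G\<^esub> h"] g h e_closed[OF g] by (simp add: m_comm)
  qed
  ultimately show "f \<in> carrier (Z1 S G D e \<alpha>)"
    using ext D(1) by (auto simp: Z1_def act_def PiE_def)
qed

section \<open>Eigenspaces and twisted traces\<close>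

definition eigenspace :: "('g \<Rightarrow> 's) \<Rightarrow> 's set"
  where "eigenspace \<phi> = {a \<in> carrier S. \<forall>g\<in>carrier G. act g a = \<phi> g \<otimes>\<^bsub>S\<^esub> a}"

lemma eigenspaceD:
  assumes "a \<in> eigenspace \<phi>"
  shows "a \<in> carrier S" "g \<in> carrier G \<Longrightarrow> act g a = \<phi> g \<otimes>\<^bsub>S\<^esub> a"
  using assms by (auto simp: eigenspace_def)

lemma invariants_eq_eigenspace: "invariants S G e \<alpha> = eigenspace e"
  by (auto simp: invariants_def eigenspace_def act_def m_comm e_closed)

lemma eigenspace_mult:
  assumes a: "a \<in> eigenspace \<phi>" and b: "b \<in> eigenspace \<psi>"
    and closed: "\<And>g. g \<in> carrier G \<Longrightarrow> \<phi> g \<in> carrier S" "\<And>g. g \<in> carrier G \<Longrightarrow> \<psi> g \<in> carrier S"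
    and eq: "\<And>g. g \<in> carrier G \<Longrightarrow> \<phi> g \<otimes>\<^bsub>S\<^esub> \<psi> g = \<chi> g"
  shows "a \<otimes>\<^bsub>S\<^esub> b \<in> eigenspace \<chi>"
  using eigenspaceD[OF a] eigenspaceD[OF b] closed
  by (auto simp: eigenspace_def act_mult S_m_ac simp flip: eq)

lemma eigenspace_zero: "(\<And>g. g \<in> carrier G \<Longrightarrow> \<phi> g \<in> carrier S) \<Longrightarrow> \<zero>\<^bsub>S\<^esub> \<in> eigenspace \<phi>"
  by (simp add: eigenspace_def act_zero)

lemma eigenspace_add:
  assumes "a \<in> eigenspace \<phi>" "b \<in> eigenspace \<phi>" "\<And>g. g \<in> carrier G \<Longrightarrow> \<phi> g \<in> carrier S"
  shows "a \<oplus>\<^bsub>S\<^esub> b \<in> eigenspace \<phi>"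
  using assms(3) eigenspaceD[OF assms(1)] eigenspaceD[OF assms(2)]
  by (auto simp: eigenspace_def act_add r_distr)

lemma eigenspace_minus:
  assumes "a \<in> eigenspace \<phi>" "\<And>g. g \<in> carrier G \<Longrightarrow> \<phi> g \<in> carrier S"
  shows "\<ominus>\<^bsub>S\<^esub> a \<in> eigenspace \<phi>"
proof -
  note a = eigenspaceD[OF assms(1)]
  have "act g (\<ominus>\<^bsub>S\<^esub> a) = \<phi> g \<otimes>\<^bsub>S\<^esub> (\<ominus>\<^bsub>S\<^esub> a)" if g: "g \<in> carrier G" for g
  proof -
    have "act g (\<ominus>\<^bsub>S\<^esub> a) \<oplus>\<^bsub>S\<^esub> act g a = \<zero>\<^bsub>S\<^esub>"
      using a(1) g by (simp add: M.l_neg act_zero flip: act_add)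
    then have "act g (\<ominus>\<^bsub>S\<^esub> a) = \<ominus>\<^bsub>S\<^esub> act g a"
      using a(1) g act_closed by (intro M.minus_equality[symmetric]) auto
    then show ?thesis using a g assms(2) by (simp add: r_minus)
  qed
  then show ?thesis using a(1) by (simp add: eigenspace_def)
qed

definition trace :: "('g \<Rightarrow> 's) \<Rightarrow> 's \<Rightarrow> 's"
  where "trace \<phi> x = (\<Oplus>\<^bsub>S\<^esub>h\<in>carrier G. \<phi> h \<otimes>\<^bsub>S\<^esub> act h x)"

text \<open>
  Applying \<open>act g\<close> to the summand \<open>\<psi>(h) act h x\<close> gives \<open>\<phi>(g)\<close> times the summand at \<open>gh\<close>, and left
  multiplication by \<open>g\<close> permutes the group.
\<close>

lemma trace_in_eigenspace:
  assumes fin: "finite (carrier G)" and coc: "inverse_cocycles \<phi> \<psi>" and x: "x \<in> carrier S"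
  shows "trace \<psi> x \<in> eigenspace \<phi>"
proof -
  note D = inverse_cocyclesD[OF coc]
  define t where "t h = \<psi> h \<otimes>\<^bsub>S\<^esub> act h x" for h
  have t: "t \<in> carrier G \<rightarrow> carrier S"
    using D(2) x by (auto simp: t_def act_closed)
  have trace_eq: "trace \<psi> x = (\<Oplus>\<^bsub>S\<^esub>h\<in>carrier G. t h)" by (simp add: trace_def t_def)
  have act_t: "act g (t h) = \<phi> g \<otimes>\<^bsub>S\<^esub> t (g \<otimes>\<^bsub>G\<^esub> h)" if g: "g \<in> carrier G" and h: "h \<in> carrier G" for g h
  proof -
    have gh: "g \<otimes>\<^bsub>G\<^esub> h \<in> carrier G" using g h by simp
    note cl = D(1,2)[OF g] D(1,2)[OF h] D(1,2)[OF gh] act_closed[OF h x] act_closed[OF gh x] e_closed[OF g]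
    have "act g (t h) = (\<phi> g \<otimes>\<^bsub>S\<^esub> \<psi> (g \<otimes>\<^bsub>G\<^esub> h)) \<otimes>\<^bsub>S\<^esub> (e g \<otimes>\<^bsub>S\<^esub> act (g \<otimes>\<^bsub>G\<^esub> h) x)"
      using cl g h x by (simp add: t_def act_mult act_act inverse_cocycles_act[OF coc])
    also have "\<dots> = (e g \<otimes>\<^bsub>S\<^esub> \<phi> g) \<otimes>\<^bsub>S\<^esub> t (g \<otimes>\<^bsub>G\<^esub> h)"
      unfolding t_def using cl by (simp add: S_m_ac)
    finally show ?thesis using D(6)[OF g] by simp
  qed
  have "act g (trace \<psi> x) = \<phi> g \<otimes>\<^bsub>S\<^esub> trace \<psi> x" if g: "g \<in> carrier G" for g
  proof -
    have tg: "(\<lambda>h. t (g \<otimes>\<^bsub>G\<^esub> h)) \<in> carrier G \<rightarrow> carrier S" using t g by auto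
    have "act g (trace \<psi> x) = (\<Oplus>\<^bsub>S\<^esub>h\<in>carrier G. act g (t h))"
      using act_finsum[OF g fin t] by (simp add: trace_eq)
    also have "\<dots> = (\<Oplus>\<^bsub>S\<^esub>h\<in>carrier G. \<phi> g \<otimes>\<^bsub>S\<^esub> t (g \<otimes>\<^bsub>G\<^esub> h))"
      using D(1)[OF g] tg by (intro M.finsum_cong') (auto simp: act_t g)
    also have "\<dots> = \<phi> g \<otimes>\<^bsub>S\<^esub> (\<Oplus>\<^bsub>S\<^esub>h\<in>carrier G. t (g \<otimes>\<^bsub>G\<^esub> h))"
      using finsum_rdistr[OF fin D(1)[OF g] tg] by simp
    also have "(\<Oplus>\<^bsub>S\<^esub>h\<in>carrier G. t (g \<otimes>\<^bsub>G\<^esub> h)) = (\<Oplus>\<^bsub>S\<^esub>h\<in>(\<lambda>h. g \<otimes>\<^bsub>G\<^esub> h) ` carrier G. t h)"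
      using t g by (intro M.finsum_reindex[symmetric] inj_on_cmult) auto
    also have "(\<lambda>h. g \<otimes>\<^bsub>G\<^esub> h) ` carrier G = carrier G" using g by (rule surj_const_mult)
    finally show ?thesis by (simp add: trace_eq)
  qed
  moreover have "trace \<psi> x \<in> carrier S"
    using M.finsum_closed[OF t] by (simp add: trace_eq)
  ultimately show ?thesis by (simp add: eigenspace_def)
qed

text \<open>
  On the eigenspace the twist is undone: \<open>\<psi>(g) act g a = \<psi>(g) \<phi>(g) a = 1\<^sub>g a\<close>.  With \<open>x = w\<close> of trace
  one this exhibits every eigenvector \<open>a\<close> as the twisted trace of \<open>a\<close> itself.
\<close>

lemma trace_mult_eigenspace:
  assumes fin: "finite (carrier G)" and coc: "inverse_cocycles \<phi> \<psi>" and x: "x \<in> carrier S"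
    and a: "a \<in> eigenspace \<phi>"
  shows "trace \<psi> (x \<otimes>\<^bsub>S\<^esub> a) = (\<Oplus>\<^bsub>S\<^esub>g\<in>carrier G. act g x) \<otimes>\<^bsub>S\<^esub> a"
proof -
  note D = inverse_cocyclesD[OF coc]
  note a' = eigenspaceD[OF a]
  have "\<psi> g \<otimes>\<^bsub>S\<^esub> act g (x \<otimes>\<^bsub>S\<^esub> a) = act g x \<otimes>\<^bsub>S\<^esub> a" if g: "g \<in> carrier G" for g
  proof -
    have "\<psi> g \<otimes>\<^bsub>S\<^esub> act g (x \<otimes>\<^bsub>S\<^esub> a) = (\<phi> g \<otimes>\<^bsub>S\<^esub> \<psi> g) \<otimes>\<^bsub>S\<^esub> act g x \<otimes>\<^bsub>S\<^esub> a"
      using D(1,2)[OF g] a' x g act_closed[OF g x] by (simp add: act_mult S_m_ac)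
    then show ?thesis using D(5)[OF g] e_act[OF g x] by simp
  qed
  then have "trace \<psi> (x \<otimes>\<^bsub>S\<^esub> a) = (\<Oplus>\<^bsub>S\<^esub>g\<in>carrier G. act g x \<otimes>\<^bsub>S\<^esub> a)"
    unfolding trace_def using a' x act_closed by (intro M.finsum_cong') auto
  also have "\<dots> = (\<Oplus>\<^bsub>S\<^esub>g\<in>carrier G. act g x) \<otimes>\<^bsub>S\<^esub> a"
    using a' x act_closed by (intro finsum_ldistr[symmetric] fin) auto
  finally show ?thesis .
qed

lemma twisted_trace_eq_trace:
  assumes coc: "inverse_cocycles f \<psi>" and w: "w \<in> carrier S" and x: "x \<in> carrier S"
  shows "twisted_trace S G D e \<alpha> w f x = trace \<psi> (w \<otimes>\<^bsub>S\<^esub> x)"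
proof -
  note D = inverse_cocyclesD[OF coc]
  have inv: "inv\<^bsub>ideal_ring S D e h\<^esub> (f h) = \<psi> h" if h: "h \<in> carrier G" for h
  proof -
    have "monoid (ideal_ring S D e h)"
      using D_subset[OF h] e_identity[OF h] e_in_D[OF h] D_mult[OF h] e_closed[OF h]
      by (intro monoidI) (auto simp: S_m_ac(1) m_comm[of _ "e h"])
    then show ?thesis
      using D[OF h] by (intro monoid.inv_char) (auto simp: m_comm)
  qed
  show ?thesis
    unfolding twisted_trace_def trace_def using D(2) w x act_closed
    by (intro M.finsum_cong') (auto simp: inv act_def)
qed

lemma carrier_Q_module:
  assumes fin: "finite (carrier G)" and w: "w \<in> carrier S"
    and w_trace: "(\<Oplus>\<^bsub>S\<^esub>h\<in>carrier G. act h w) = \<one>\<^bsub>S\<^esub>" and coc: "inverse_cocycles f \<psi>"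
  shows "carrier (Q_module S G D e \<alpha> w f) = eigenspace f"
proof -
  have "twisted_trace S G D e \<alpha> w f x \<in> eigenspace f" if "x \<in> carrier S" for x
    using that w by (simp add: twisted_trace_eq_trace[OF coc] trace_in_eigenspace[OF fin coc])
  moreover have "a \<in> twisted_trace S G D e \<alpha> w f ` carrier S" if a: "a \<in> eigenspace f" for a
  proof
    show "a \<in> carrier S" using eigenspaceD[OF a] by simp
    then show "a = twisted_trace S G D e \<alpha> w f a"
      using w a by (simp add: twisted_trace_eq_trace[OF coc] trace_mult_eigenspace[OF fin coc]
          w_trace monoid.l_one[OF monoid_S])
  qed
  ultimately show ?thesis by (auto simp: Q_module_def)
qed

lemma module_Q_module:
  assumes ring: "subring (invariants S G e \<alpha>) S"
    and carrier: "carrier (Q_module S G D e \<alpha> w f) = eigenspace f"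
    and f: "\<And>g. g \<in> carrier G \<Longrightarrow> f g \<in> carrier S \<and> e g \<otimes>\<^bsub>S\<^esub> f g = f g"
  shows "module (S\<lparr>carrier := invariants S G e \<alpha>\<rparr>) (Q_module S G D e \<alpha> w f)"
    (is "module ?R ?Q")
proof (rule moduleI)
  note ops = Q_module_def[of S G D e \<alpha> w f]
  have R: "x \<in> carrier ?R \<longleftrightarrow> x \<in> eigenspace e" for x
    by (simp add: invariants_eq_eigenspace)
  have Q: "x \<in> carrier ?Q \<longleftrightarrow> x \<in> eigenspace f" for x by (simp add: carrier)
  have fc: "\<And>g. g \<in> carrier G \<Longrightarrow> f g \<in> carrier S" using f by blast
  interpret inv: ring ?R using subring_is_ring[OF ring] .
  show "cring ?R"
    by (rule cring.intro[OF inv.ring_axioms], rule comm_monoidI)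
      (use inv.m_closed inv.one_closed inv.m_assoc eigenspaceD(1) in \<open>auto simp: invariants_eq_eigenspace m_comm\<close>)
  show "abelian_group ?Q"
  proof (rule abelian_groupI)
    show "x \<oplus>\<^bsub>?Q\<^esub> y \<in> carrier ?Q" if "x \<in> carrier ?Q" "y \<in> carrier ?Q" for x y
      using that eigenspace_add fc by (simp add: Q) (simp add: ops)
    show "\<zero>\<^bsub>?Q\<^esub> \<in> carrier ?Q"
      using eigenspace_zero fc by (simp add: Q) (simp add: ops)
    show "x \<oplus>\<^bsub>?Q\<^esub> y \<oplus>\<^bsub>?Q\<^esub> z = x \<oplus>\<^bsub>?Q\<^esub> (y \<oplus>\<^bsub>?Q\<^esub> z)"
      if "x \<in> carrier ?Q" "y \<in> carrier ?Q" "z \<in> carrier ?Q" for x y z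
      using that[unfolded Q, THEN eigenspaceD(1)] by (simp add: ops M.a_assoc)
    show "x \<oplus>\<^bsub>?Q\<^esub> y = y \<oplus>\<^bsub>?Q\<^esub> x" if "x \<in> carrier ?Q" "y \<in> carrier ?Q" for x y
      using that[unfolded Q, THEN eigenspaceD(1)] by (simp add: ops M.a_comm)
    show "\<zero>\<^bsub>?Q\<^esub> \<oplus>\<^bsub>?Q\<^esub> x = x" if "x \<in> carrier ?Q" for x
      using that[unfolded Q, THEN eigenspaceD(1)] by (simp add: ops)
    show "\<exists>y\<in>carrier ?Q. y \<oplus>\<^bsub>?Q\<^esub> x = \<zero>\<^bsub>?Q\<^esub>" if "x \<in> carrier ?Q" for x
      unfolding carrier using that[unfolded Q, THEN eigenspaceD(1)] eigenspace_minus[OF that[unfolded Q] fc]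
      by (intro bexI[of _ "\<ominus>\<^bsub>S\<^esub> x"]) (simp_all add: ops M.l_neg)
  qed
  show "\<one>\<^bsub>?R\<^esub> \<odot>\<^bsub>?Q\<^esub> x = x" if "x \<in> carrier ?Q" for x
    using that[unfolded Q, THEN eigenspaceD(1)] by (simp add: ops monoid.l_one[OF monoid_S])
  fix a b x y
  assume a: "a \<in> carrier ?R" and x: "x \<in> carrier ?Q"
  note ax = a[unfolded R, THEN eigenspaceD(1)] x[unfolded Q, THEN eigenspaceD(1)]
  show "a \<odot>\<^bsub>?Q\<^esub> x \<in> carrier ?Q"
    using eigenspace_mult[OF a[unfolded R] x[unfolded Q], of f] f e_closed by (simp add: Q) (simp add: ops)
  {
    assume "b \<in> carrier ?R"
    note b = this[unfolded R, THEN eigenspaceD(1)]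
    show "(a \<oplus>\<^bsub>?R\<^esub> b) \<odot>\<^bsub>?Q\<^esub> x = a \<odot>\<^bsub>?Q\<^esub> x \<oplus>\<^bsub>?Q\<^esub> b \<odot>\<^bsub>?Q\<^esub> x"
      using ax b by (simp add: ops l_distr)
    show "a \<otimes>\<^bsub>?R\<^esub> b \<odot>\<^bsub>?Q\<^esub> x = a \<odot>\<^bsub>?Q\<^esub> (b \<odot>\<^bsub>?Q\<^esub> x)"
      using ax b by (simp add: ops S_m_ac(1))
  }
  assume "y \<in> carrier ?Q"
  note y = this[unfolded Q, THEN eigenspaceD(1)]
  show "a \<odot>\<^bsub>?Q\<^esub> (x \<oplus>\<^bsub>?Q\<^esub> y) = a \<odot>\<^bsub>?Q\<^esub> x \<oplus>\<^bsub>?Q\<^esub> a \<odot>\<^bsub>?Q\<^esub> y"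
    using ax y by (simp add: ops r_distr)
qed

lemma finsum_Q_module:
  assumes "abelian_group (Q_module S G D e \<alpha> w f)" "finite I"
    and "x \<in> I \<rightarrow> carrier (Q_module S G D e \<alpha> w f)" "carrier (Q_module S G D e \<alpha> w f) \<subseteq> carrier S"
  shows "finsum (Q_module S G D e \<alpha> w f) x I = finsum S x I"
proof -
  interpret Q: abelian_group "Q_module S G D e \<alpha> w f" by fact
  show ?thesis
    using assms(2,3)
  proof (induction I rule: finite_induct)
    case empty
    have "\<zero>\<^bsub>Q_module S G D e \<alpha> w f\<^esub> = \<zero>\<^bsub>S\<^esub>" by (simp add: Q_module_def)
    then show ?case by simp
  next
    case (insert i I)
    have "x i \<oplus>\<^bsub>Q_module S G D e \<alpha> w f\<^esub> y = x i \<oplus>\<^bsub>S\<^esub> y" for y by (simp add: Q_module_def)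
    moreover have "x \<in> I \<rightarrow> carrier S" "x i \<in> carrier S" using insert assms(4) by auto
    ultimately show ?case using insert by simp
  qed
qed

section \<open>Galois coordinates and invertibility of eigenspaces\<close>

lemma finsum_swap:
  assumes "finite I" "finite J" "\<And>i j. i \<in> I \<Longrightarrow> j \<in> J \<Longrightarrow> x i j \<in> carrier S"
  shows "(\<Oplus>\<^bsub>S\<^esub>i\<in>I. \<Oplus>\<^bsub>S\<^esub>j\<in>J. x i j) = (\<Oplus>\<^bsub>S\<^esub>j\<in>J. \<Oplus>\<^bsub>S\<^esub>i\<in>I. x i j)"
  using assms(1,3)
proof (induction I rule: finite_induct)
  case empty
  then show ?case by simp
next
  case (insert i I)
  have cl: "(\<lambda>j. x i j) \<in> J \<rightarrow> carrier S" "(\<lambda>j. \<Oplus>\<^bsub>S\<^esub>i\<in>I. x i j) \<in> J \<rightarrow> carrier S"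
    "(\<lambda>i. \<Oplus>\<^bsub>S\<^esub>j\<in>J. x i j) \<in> I \<rightarrow> carrier S" "(\<Oplus>\<^bsub>S\<^esub>j\<in>J. x i j) \<in> carrier S"
    using insert by (auto intro!: M.finsum_closed)
  have "(\<Oplus>\<^bsub>S\<^esub>i\<in>insert i I. \<Oplus>\<^bsub>S\<^esub>j\<in>J. x i j)
      = (\<Oplus>\<^bsub>S\<^esub>j\<in>J. x i j) \<oplus>\<^bsub>S\<^esub> (\<Oplus>\<^bsub>S\<^esub>j\<in>J. \<Oplus>\<^bsub>S\<^esub>i\<in>I. x i j)"
    using insert cl by simp
  also have "\<dots> = (\<Oplus>\<^bsub>S\<^esub>j\<in>J. x i j \<oplus>\<^bsub>S\<^esub> (\<Oplus>\<^bsub>S\<^esub>i\<in>I. x i j))"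
    using M.finsum_addf[OF cl(1,2)] by simp
  also have "\<dots> = (\<Oplus>\<^bsub>S\<^esub>j\<in>J. \<Oplus>\<^bsub>S\<^esub>i\<in>insert i I. x i j)"
    using insert by (intro M.finsum_cong' M.finsum_insert[symmetric]) (auto intro!: M.finsum_closed)
  finally show ?case .
qed

text \<open>
  Apply \<open>act g\<close> to the relation for \<open>g\<inverse>h\<close>.
\<close>

lemma galois_coordinates_translate:
  assumes "finite I" "x \<in> I \<rightarrow> carrier S" "y \<in> I \<rightarrow> carrier S"
    and coords: "\<And>g. g \<in> carrier G \<Longrightarrow>
      (\<Oplus>\<^bsub>S\<^esub>i\<in>I. x i \<otimes>\<^bsub>S\<^esub> act g (y i)) = (if g = \<one>\<^bsub>G\<^esub> then \<one>\<^bsub>S\<^esub> else \<zero>\<^bsub>S\<^esub>)"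
    and g: "g \<in> carrier G" and h: "h \<in> carrier G"
  shows "(\<Oplus>\<^bsub>S\<^esub>i\<in>I. act g (x i) \<otimes>\<^bsub>S\<^esub> act h (y i)) = (if g = h then e g else \<zero>\<^bsub>S\<^esub>)"
proof -
  let ?k = "inv\<^bsub>G\<^esub> g \<otimes>\<^bsub>G\<^esub> h"
  have k: "?k \<in> carrier G" "g \<otimes>\<^bsub>G\<^esub> ?k = h" using g h by (simp_all flip: m_assoc)
  have "act g (x i) \<otimes>\<^bsub>S\<^esub> act h (y i) = act g (x i \<otimes>\<^bsub>S\<^esub> act ?k (y i))" if i: "i \<in> I" for i
  proof -
    have xy: "x i \<in> carrier S" "y i \<in> carrier S" using i assms(2,3) by auto
    have "act g (x i \<otimes>\<^bsub>S\<^esub> act ?k (y i)) = act g (x i) \<otimes>\<^bsub>S\<^esub> (e g \<otimes>\<^bsub>S\<^esub> act h (y i))"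
      using xy g k by (simp add: act_mult act_closed act_act)
    also have "\<dots> = (e g \<otimes>\<^bsub>S\<^esub> act g (x i)) \<otimes>\<^bsub>S\<^esub> act h (y i)"
      using xy g h by (simp add: act_closed e_closed S_m_ac)
    finally show ?thesis using xy g by (simp add: e_act)
  qed
  then have "(\<Oplus>\<^bsub>S\<^esub>i\<in>I. act g (x i) \<otimes>\<^bsub>S\<^esub> act h (y i)) = (\<Oplus>\<^bsub>S\<^esub>i\<in>I. act g (x i \<otimes>\<^bsub>S\<^esub> act ?k (y i)))"
    using assms(2,3) g k(1) by (intro M.finsum_cong') (auto intro!: act_closed)
  also have "\<dots> = act g (\<Oplus>\<^bsub>S\<^esub>i\<in>I. x i \<otimes>\<^bsub>S\<^esub> act ?k (y i))"
    using assms(2,3) g k(1) by (intro act_finsum[symmetric] assms(1)) (auto intro!: act_closed)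
  also have "\<dots> = (if g = h then e g else \<zero>\<^bsub>S\<^esub>)"
  proof -
    have "?k = \<one>\<^bsub>G\<^esub> \<longleftrightarrow> g = h"
      using k g h by (metis l_inv r_one)
    then show ?thesis using coords[OF k(1)] g h by (cases "g = h") (simp_all add: act_one act_zero)
  qed
  finally show ?thesis .
qed

text \<open>
  By the translated coordinate relations, only the diagonal terms survive in
  \<open>\<Sum>\<^sub>i (\<Sum>\<^sub>g \<psi>(g) act g (w x\<^sub>i)) (\<Sum>\<^sub>h \<phi>(h) act h y\<^sub>i)\<close>, and since \<open>\<phi>(g) \<psi>(g) = 1\<^sub>g\<close> they add up to the
  trace of \<open>w\<close>.  The factor \<open>w\<close> is essential: without it the sum would be \<open>\<Sum>\<^sub>g 1\<^sub>g\<close>.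
\<close>

lemma trace_dual_basis:
  assumes fin: "finite (carrier G)" and I: "finite I" "x \<in> I \<rightarrow> carrier S" "y \<in> I \<rightarrow> carrier S"
    and coords: "\<And>g. g \<in> carrier G \<Longrightarrow>
      (\<Oplus>\<^bsub>S\<^esub>i\<in>I. x i \<otimes>\<^bsub>S\<^esub> act g (y i)) = (if g = \<one>\<^bsub>G\<^esub> then \<one>\<^bsub>S\<^esub> else \<zero>\<^bsub>S\<^esub>)"
    and w: "w \<in> carrier S" and w_trace: "(\<Oplus>\<^bsub>S\<^esub>h\<in>carrier G. act h w) = \<one>\<^bsub>S\<^esub>"
    and coc: "inverse_cocycles \<phi> \<psi>"
  shows "(\<Oplus>\<^bsub>S\<^esub>i\<in>I. trace \<psi> (w \<otimes>\<^bsub>S\<^esub> x i) \<otimes>\<^bsub>S\<^esub> trace \<phi> (y i)) = \<one>\<^bsub>S\<^esub>"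
proof -
  note D = inverse_cocyclesD[OF coc]
  have xc: "x i \<in> carrier S" and yc: "y i \<in> carrier S" if "i \<in> I" for i using I that by auto
  define v where "v i = trace \<phi> (y i)" for i
  have v: "v i \<in> carrier S" if "i \<in> I" for i
    using trace_in_eigenspace[OF fin inverse_cocycles_sym[OF coc] yc[OF that]] eigenspaceD(1) by (simp add: v_def)
  have v_sum: "(\<Oplus>\<^bsub>S\<^esub>i\<in>I. act g (x i) \<otimes>\<^bsub>S\<^esub> v i) = \<phi> g" if g: "g \<in> carrier G" for g
  proof -
    have "(\<Oplus>\<^bsub>S\<^esub>i\<in>I. act g (x i) \<otimes>\<^bsub>S\<^esub> v i)
        = (\<Oplus>\<^bsub>S\<^esub>i\<in>I. \<Oplus>\<^bsub>S\<^esub>h\<in>carrier G. \<phi> h \<otimes>\<^bsub>S\<^esub> (act g (x i) \<otimes>\<^bsub>S\<^esub> act h (y i)))"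
    proof (rule M.finsum_cong')
      fix i assume i: "i \<in> I"
      have "act g (x i) \<otimes>\<^bsub>S\<^esub> v i = (\<Oplus>\<^bsub>S\<^esub>h\<in>carrier G. act g (x i) \<otimes>\<^bsub>S\<^esub> (\<phi> h \<otimes>\<^bsub>S\<^esub> act h (y i)))"
        unfolding v_def trace_def using D(1) xc[OF i] yc[OF i] g
        by (intro finsum_rdistr fin) (auto simp: act_closed)
      also have "\<dots> = (\<Oplus>\<^bsub>S\<^esub>h\<in>carrier G. \<phi> h \<otimes>\<^bsub>S\<^esub> (act g (x i) \<otimes>\<^bsub>S\<^esub> act h (y i)))"
        using D(1) act_closed[OF _ xc[OF i]] act_closed[OF _ yc[OF i]] g
        by (intro M.finsum_cong' refl m_lcomm) auto
      finally show "act g (x i) \<otimes>\<^bsub>S\<^esub> v i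
          = (\<Oplus>\<^bsub>S\<^esub>h\<in>carrier G. \<phi> h \<otimes>\<^bsub>S\<^esub> (act g (x i) \<otimes>\<^bsub>S\<^esub> act h (y i)))" .
    qed (use D(1) xc yc g in \<open>auto simp: act_closed intro!: M.finsum_closed\<close>)
    also have "\<dots> = (\<Oplus>\<^bsub>S\<^esub>h\<in>carrier G. \<Oplus>\<^bsub>S\<^esub>i\<in>I. \<phi> h \<otimes>\<^bsub>S\<^esub> (act g (x i) \<otimes>\<^bsub>S\<^esub> act h (y i)))"
      using D(1) xc yc g by (intro finsum_swap fin I) (auto simp: act_closed)
    also have "\<dots> = (\<Oplus>\<^bsub>S\<^esub>h\<in>carrier G. if g = h then \<phi> h else \<zero>\<^bsub>S\<^esub>)"
    proof (rule M.finsum_cong')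
      fix h assume h: "h \<in> carrier G"
      have "(\<Oplus>\<^bsub>S\<^esub>i\<in>I. \<phi> h \<otimes>\<^bsub>S\<^esub> (act g (x i) \<otimes>\<^bsub>S\<^esub> act h (y i)))
          = \<phi> h \<otimes>\<^bsub>S\<^esub> (\<Oplus>\<^bsub>S\<^esub>i\<in>I. act g (x i) \<otimes>\<^bsub>S\<^esub> act h (y i))"
        using D(1)[OF h] xc yc g h by (intro finsum_rdistr[symmetric] I) (auto simp: act_closed)
      also have "\<dots> = (if g = h then \<phi> h else \<zero>\<^bsub>S\<^esub>)"
        using galois_coordinates_translate[OF I coords g h] D(1,6)[OF h] e_closed[OF h]
        by (auto simp: m_comm)
      finally show "(\<Oplus>\<^bsub>S\<^esub>i\<in>I. \<phi> h \<otimes>\<^bsub>S\<^esub> (act g (x i) \<otimes>\<^bsub>S\<^esub> act h (y i))) = (if g = h then \<phi> h else \<zero>\<^bsub>S\<^esub>)" .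
    qed (use D(1) in auto)
    also have "\<dots> = \<phi> g"
      using D(1) g by (intro M.finsum_singleton fin) auto
    finally show ?thesis .
  qed
  have "(\<Oplus>\<^bsub>S\<^esub>i\<in>I. trace \<psi> (w \<otimes>\<^bsub>S\<^esub> x i) \<otimes>\<^bsub>S\<^esub> v i)
      = (\<Oplus>\<^bsub>S\<^esub>i\<in>I. \<Oplus>\<^bsub>S\<^esub>g\<in>carrier G. (\<psi> g \<otimes>\<^bsub>S\<^esub> act g w) \<otimes>\<^bsub>S\<^esub> (act g (x i) \<otimes>\<^bsub>S\<^esub> v i))"
  proof (rule M.finsum_cong')
    fix i assume i: "i \<in> I"
    have "trace \<psi> (w \<otimes>\<^bsub>S\<^esub> x i) \<otimes>\<^bsub>S\<^esub> v i = (\<Oplus>\<^bsub>S\<^esub>g\<in>carrier G. (\<psi> g \<otimes>\<^bsub>S\<^esub> act g (w \<otimes>\<^bsub>S\<^esub> x i)) \<otimes>\<^bsub>S\<^esub> v i)"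
      unfolding trace_def using D(2) xc[OF i] v[OF i] w
      by (intro finsum_ldistr fin) (auto simp: act_closed)
    also have "\<dots> = (\<Oplus>\<^bsub>S\<^esub>g\<in>carrier G. (\<psi> g \<otimes>\<^bsub>S\<^esub> act g w) \<otimes>\<^bsub>S\<^esub> (act g (x i) \<otimes>\<^bsub>S\<^esub> v i))"
      using D(2) xc[OF i] v[OF i] w act_closed[OF _ xc[OF i]] act_closed[OF _ w]
      by (intro M.finsum_cong' refl) (auto simp: act_mult S_m_ac(1))
    finally show "trace \<psi> (w \<otimes>\<^bsub>S\<^esub> x i) \<otimes>\<^bsub>S\<^esub> v i
        = (\<Oplus>\<^bsub>S\<^esub>g\<in>carrier G. (\<psi> g \<otimes>\<^bsub>S\<^esub> act g w) \<otimes>\<^bsub>S\<^esub> (act g (x i) \<otimes>\<^bsub>S\<^esub> v i))" .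
  qed (use D(2) xc v w in \<open>auto simp: act_closed intro!: M.finsum_closed\<close>)
  also have "\<dots> = (\<Oplus>\<^bsub>S\<^esub>g\<in>carrier G. \<Oplus>\<^bsub>S\<^esub>i\<in>I. (\<psi> g \<otimes>\<^bsub>S\<^esub> act g w) \<otimes>\<^bsub>S\<^esub> (act g (x i) \<otimes>\<^bsub>S\<^esub> v i))"
    using D(2) xc v w by (intro finsum_swap fin I) (auto simp: act_closed)
  also have "\<dots> = (\<Oplus>\<^bsub>S\<^esub>g\<in>carrier G. act g w)"
  proof (rule M.finsum_cong')
    fix g assume g: "g \<in> carrier G"
    have "(\<Oplus>\<^bsub>S\<^esub>i\<in>I. (\<psi> g \<otimes>\<^bsub>S\<^esub> act g w) \<otimes>\<^bsub>S\<^esub> (act g (x i) \<otimes>\<^bsub>S\<^esub> v i))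
        = (\<psi> g \<otimes>\<^bsub>S\<^esub> act g w) \<otimes>\<^bsub>S\<^esub> (\<Oplus>\<^bsub>S\<^esub>i\<in>I. act g (x i) \<otimes>\<^bsub>S\<^esub> v i)"
      using D(2)[OF g] xc v w g by (intro finsum_rdistr[symmetric] I) (auto simp: act_closed)
    also have "\<dots> = (\<phi> g \<otimes>\<^bsub>S\<^esub> \<psi> g) \<otimes>\<^bsub>S\<^esub> act g w"
      using D(1,2)[OF g] act_closed[OF g w] by (simp add: v_sum[OF g] S_m_ac)
    also have "\<dots> = act g w" using D(5)[OF g] e_act[OF g w] by simp
    finally show "(\<Oplus>\<^bsub>S\<^esub>i\<in>I. (\<psi> g \<otimes>\<^bsub>S\<^esub> act g w) \<otimes>\<^bsub>S\<^esub> (act g (x i) \<otimes>\<^bsub>S\<^esub> v i)) = act g w" .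
  qed (use w in \<open>auto simp: act_closed\<close>)
  finally show ?thesis by (simp add: v_def w_trace)
qed

end

section \<open>The multiplication map on eigenspaces\<close>

context partial_galois_extension
begin

lemma galois_coordinates_act:
  obtains m :: nat and x y where "x \<in> {1..m} \<rightarrow> carrier S" "y \<in> {1..m} \<rightarrow> carrier S"
    "\<And>g. g \<in> carrier G \<Longrightarrow>
      (\<Oplus>\<^bsub>S\<^esub>i\<in>{1..m}. x i \<otimes>\<^bsub>S\<^esub> act g (y i)) = (if g = \<one>\<^bsub>G\<^esub> then \<one>\<^bsub>S\<^esub> else \<zero>\<^bsub>S\<^esub>)"
  using galois_coordinates that unfolding act_def by blast

lemma Q_module_pairing:
  assumes fin: "finite (carrier G)" and w: "w \<in> carrier S"
    and w_trace: "(\<Oplus>\<^bsub>S\<^esub>h\<in>carrier G. act h w) = \<one>\<^bsub>S\<^esub>"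
    and f: "inverse_cocycles f f'" and g: "inverse_cocycles g g'"
    and fg: "inverse_cocycles fg fg'" and eq: "\<And>h. h \<in> carrier G \<Longrightarrow> fg h = f h \<otimes>\<^bsub>S\<^esub> g h"
  shows "bilinear_pairing (S\<lparr>carrier := R\<rparr>) (Q_module S G D e \<alpha> w f) (Q_module S G D e \<alpha> w g)
           (Q_module S G D e \<alpha> w fg) (monoid.mult S)"
proof -
  let ?Q = "Q_module S G D e \<alpha> w"
  have Q: "carrier (?Q \<phi>) = eigenspace \<phi>" if "inverse_cocycles \<phi> \<psi>" for \<phi> \<psi>
    using carrier_Q_module[OF fin w w_trace that] .
  have mod: "module (S\<lparr>carrier := R\<rparr>) (?Q \<phi>)" if "inverse_cocycles \<phi> \<psi>" for \<phi> \<psi>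
    unfolding R_eq_invariants
    by (rule module_Q_module[OF subring_R[unfolded R_eq_invariants] Q[OF that]])
      (use inverse_cocyclesD[OF that] in blast)
  have ops: "x \<oplus>\<^bsub>?Q \<phi>\<^esub> y = x \<oplus>\<^bsub>S\<^esub> y" "r \<odot>\<^bsub>?Q \<phi>\<^esub> x = r \<otimes>\<^bsub>S\<^esub> x" for x y r \<phi>
    by (simp_all add: Q_module_def)
  note closed = eigenspaceD(1)
  show ?thesis
  proof (intro bilinear_pairing.intro module_pair.intro bilinear_pairing_axioms.intro mod[OF f] mod[OF g] mod[OF fg])
    fix a a' b b' r
    assume a: "a \<in> carrier (?Q f)" and b: "b \<in> carrier (?Q g)"
    then have ab: "a \<in> eigenspace f" "b \<in> eigenspace g" by (simp_all add: Q[OF f] Q[OF g])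
    show "a \<otimes>\<^bsub>S\<^esub> b \<in> carrier (?Q fg)"
      unfolding Q[OF fg] using ab
      by (rule eigenspace_mult) (simp_all add: inverse_cocyclesD[OF f] inverse_cocyclesD[OF g] eq)
    {
      assume "a' \<in> carrier (?Q f)"
      then have "a' \<in> carrier S" using closed by (simp add: Q[OF f])
      then show "(a \<oplus>\<^bsub>?Q f\<^esub> a') \<otimes>\<^bsub>S\<^esub> b = a \<otimes>\<^bsub>S\<^esub> b \<oplus>\<^bsub>?Q fg\<^esub> a' \<otimes>\<^bsub>S\<^esub> b"
        using ab[THEN closed] by (simp add: ops l_distr)
    next
      assume "b' \<in> carrier (?Q g)"
      then have "b' \<in> carrier S" using closed by (simp add: Q[OF g])
      then show "a \<otimes>\<^bsub>S\<^esub> (b \<oplus>\<^bsub>?Q g\<^esub> b') = a \<otimes>\<^bsub>S\<^esub> b \<oplus>\<^bsub>?Q fg\<^esub> a \<otimes>\<^bsub>S\<^esub> b'"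
        using ab[THEN closed] by (simp add: ops r_distr)
    next
      assume "r \<in> carrier (S\<lparr>carrier := R\<rparr>)"
      then have r: "r \<in> carrier S" by (simp add: R_eq_invariants invariants_def)
      show "(r \<odot>\<^bsub>?Q f\<^esub> a) \<otimes>\<^bsub>S\<^esub> b = r \<odot>\<^bsub>?Q fg\<^esub> (a \<otimes>\<^bsub>S\<^esub> b)"
        using r ab[THEN closed] by (simp add: ops S_m_ac(1))
      show "a \<otimes>\<^bsub>S\<^esub> (r \<odot>\<^bsub>?Q g\<^esub> b) = r \<odot>\<^bsub>?Q fg\<^esub> (a \<otimes>\<^bsub>S\<^esub> b)"
        using r ab[THEN closed] by (simp add: ops m_lcomm)
    }
  qed
qed

text \<open>
  The dual basis criterion applies with \<open>\<mu>\<^sub>i(a) = v\<^sub>i a\<close>, which is invariant because \<open>v\<^sub>i\<close> belongs to the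
  inverse cocycle of \<open>f\<close>, and with \<open>\<kappa>\<^sub>i(c) = v\<^sub>i c\<close>, which leads from the eigenspace of \<open>f g\<close> to that
  of \<open>g\<close>.  Its hypotheses all reduce to \<open>\<Sum>\<^sub>i u\<^sub>i v\<^sub>i = 1\<close>.
\<close>

lemma Q_module_tensor_iso:
  assumes fin: "finite (carrier G)" and w: "w \<in> carrier S"
    and w_trace: "(\<Oplus>\<^bsub>S\<^esub>h\<in>carrier G. act h w) = \<one>\<^bsub>S\<^esub>"
    and f: "inverse_cocycles f f'" and g: "inverse_cocycles g g'"
    and fg: "inverse_cocycles fg fg'" and eq: "\<And>h. h \<in> carrier G \<Longrightarrow> fg h = f h \<otimes>\<^bsub>S\<^esub> g h"
    and \<psi>: "\<psi> \<in> mod_hom (S\<lparr>carrier := R\<rparr>)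
      (tensor_product (S\<lparr>carrier := R\<rparr>) (Q_module S G D e \<alpha> w f) (Q_module S G D e \<alpha> w g))
      (Q_module S G D e \<alpha> w fg)"
    and \<psi>_pure: "\<And>a b. \<lbrakk>a \<in> carrier (Q_module S G D e \<alpha> w f); b \<in> carrier (Q_module S G D e \<alpha> w g)\<rbrakk>
      \<Longrightarrow> \<psi> (pure_tensor (S\<lparr>carrier := R\<rparr>) (Q_module S G D e \<alpha> w f) (Q_module S G D e \<alpha> w g) a b)
        = a \<otimes>\<^bsub>S\<^esub> b"
  shows "\<psi> \<in> mod_iso (S\<lparr>carrier := R\<rparr>)
      (tensor_product (S\<lparr>carrier := R\<rparr>) (Q_module S G D e \<alpha> w f) (Q_module S G D e \<alpha> w g))
      (Q_module S G D e \<alpha> w fg)"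
proof -
  let ?Q = "Q_module S G D e \<alpha> w"
  note Df = inverse_cocyclesD[OF f] and Dg = inverse_cocyclesD[OF g]
  have Q: "carrier (?Q f) = eigenspace f" "carrier (?Q g) = eigenspace g" "carrier (?Q fg) = eigenspace fg"
    using carrier_Q_module[OF fin w w_trace] f g fg by blast+
  have ops: "x \<oplus>\<^bsub>?Q \<phi>\<^esub> y = x \<oplus>\<^bsub>S\<^esub> y" "r \<odot>\<^bsub>?Q \<phi>\<^esub> x = r \<otimes>\<^bsub>S\<^esub> x" for x y r \<phi>
    by (simp_all add: Q_module_def)
  have R: "R = eigenspace e" by (simp add: R_eq_invariants invariants_eq_eigenspace)
  note closed = eigenspaceD(1)
  interpret pairing: bilinear_pairing "S\<lparr>carrier := R\<rparr>" "?Q f" "?Q g" "?Q fg" "monoid.mult S"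
    by (rule Q_module_pairing[OF fin w w_trace f g fg eq])
  obtain m :: nat and x y where x: "x \<in> {1..m} \<rightarrow> carrier S" and y: "y \<in> {1..m} \<rightarrow> carrier S"
    and coords: "\<And>h. h \<in> carrier G \<Longrightarrow>
      (\<Oplus>\<^bsub>S\<^esub>i\<in>{1..m}. x i \<otimes>\<^bsub>S\<^esub> act h (y i)) = (if h = \<one>\<^bsub>G\<^esub> then \<one>\<^bsub>S\<^esub> else \<zero>\<^bsub>S\<^esub>)"
    by (rule galois_coordinates_act) blast
  define u where "u i = trace f' (w \<otimes>\<^bsub>S\<^esub> x i)" for i
  define v where "v i = trace f (y i)" for i
  have u: "u i \<in> eigenspace f" and v: "v i \<in> eigenspace f'" if "i \<in> {1..m}" for i
    unfolding u_def v_def using that x y w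
    by (auto intro!: trace_in_eigenspace[OF fin] f inverse_cocycles_sym[OF f])
  have uv: "(\<Oplus>\<^bsub>S\<^esub>i\<in>{1..m}. u i \<otimes>\<^bsub>S\<^esub> v i) = \<one>\<^bsub>S\<^esub>"
    unfolding u_def v_def by (rule trace_dual_basis[OF fin _ x y coords w w_trace f]) auto
  have va: "v i \<otimes>\<^bsub>S\<^esub> a \<in> eigenspace e" if "i \<in> {1..m}" "a \<in> eigenspace f" for i a
    using v[OF that(1)] that(2) by (rule eigenspace_mult) (simp_all add: Df m_comm)
  have vc: "v i \<otimes>\<^bsub>S\<^esub> c \<in> eigenspace g" if "i \<in> {1..m}" "c \<in> eigenspace fg" for i c
    using v[OF that(1)] that(2)
  proof (rule eigenspace_mult)
    fix h assume h: "h \<in> carrier G"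
    show "f' h \<in> carrier S" "fg h \<in> carrier S" using h Df Dg by (simp_all add: eq)
    have "f' h \<otimes>\<^bsub>S\<^esub> fg h = (f h \<otimes>\<^bsub>S\<^esub> f' h) \<otimes>\<^bsub>S\<^esub> g h"
      using Df(1,2)[OF h] Dg(1)[OF h] by (simp add: eq h S_m_ac)
    then show "f' h \<otimes>\<^bsub>S\<^esub> fg h = g h" using Df(5)[OF h] Dg(6)[OF h] by simp
  qed
  have expand: "(\<Oplus>\<^bsub>S\<^esub>i\<in>{1..m}. u i \<otimes>\<^bsub>S\<^esub> (v i \<otimes>\<^bsub>S\<^esub> c)) = c" if c: "c \<in> carrier S" for c
  proof -
    have "(\<Oplus>\<^bsub>S\<^esub>i\<in>{1..m}. u i \<otimes>\<^bsub>S\<^esub> (v i \<otimes>\<^bsub>S\<^esub> c)) = (\<Oplus>\<^bsub>S\<^esub>i\<in>{1..m}. (u i \<otimes>\<^bsub>S\<^esub> v i) \<otimes>\<^bsub>S\<^esub> c)"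
      using c u[THEN closed] v[THEN closed] by (intro M.finsum_cong') (auto simp: S_m_ac(1))
    also have "\<dots> = (\<Oplus>\<^bsub>S\<^esub>i\<in>{1..m}. u i \<otimes>\<^bsub>S\<^esub> v i) \<otimes>\<^bsub>S\<^esub> c"
      using c u[THEN closed] v[THEN closed] by (intro finsum_ldistr[symmetric]) auto
    also have "\<dots> = c"
      unfolding uv using c by (rule monoid.l_one[OF monoid_S])
    finally show ?thesis .
  qed
  show ?thesis
  proof (rule pairing.tensor_iso_if_dual_basis[where I = "{1..m}" and u = u
        and \<mu> = "\<lambda>i a. v i \<otimes>\<^bsub>S\<^esub> a" and \<kappa> = "\<lambda>i c. v i \<otimes>\<^bsub>S\<^esub> c"])
    show "finite {1..m}" by simp
    show "\<psi> \<in> mod_hom (S\<lparr>carrier := R\<rparr>) (tensor_product (S\<lparr>carrier := R\<rparr>) (?Q f) (?Q g)) (?Q fg)"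
      by (rule \<psi>)
  next
    fix i assume i: "i \<in> {1..m}"
    show "u i \<in> carrier (?Q f)" using u[OF i] by (simp add: Q)
    show "(\<lambda>c. v i \<otimes>\<^bsub>S\<^esub> c) \<in> mod_hom (S\<lparr>carrier := R\<rparr>) (?Q fg) (?Q g)"
      unfolding mod_hom_def
    proof (intro CollectI conjI ballI)
      show "(\<lambda>c. v i \<otimes>\<^bsub>S\<^esub> c) \<in> carrier (?Q fg) \<rightarrow> carrier (?Q g)"
        using vc[OF i] by (simp add: Q)
    next
      fix c d assume "c \<in> carrier (?Q fg)" "d \<in> carrier (?Q fg)"
      then show "v i \<otimes>\<^bsub>S\<^esub> (c \<oplus>\<^bsub>?Q fg\<^esub> d) = v i \<otimes>\<^bsub>S\<^esub> c \<oplus>\<^bsub>?Q g\<^esub> v i \<otimes>\<^bsub>S\<^esub> d"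
        using v[OF i, THEN closed] closed by (simp add: Q ops r_distr)
    next
      fix r c assume "r \<in> carrier (S\<lparr>carrier := R\<rparr>)" "c \<in> carrier (?Q fg)"
      then show "v i \<otimes>\<^bsub>S\<^esub> (r \<odot>\<^bsub>?Q fg\<^esub> c) = r \<odot>\<^bsub>?Q g\<^esub> (v i \<otimes>\<^bsub>S\<^esub> c)"
        using v[OF i, THEN closed] closed by (simp add: Q R ops m_lcomm)
    qed
    fix a assume a: "a \<in> carrier (?Q f)"
    then show "v i \<otimes>\<^bsub>S\<^esub> a \<in> carrier (S\<lparr>carrier := R\<rparr>)"
      using va[OF i] by (simp add: Q R)
    fix b assume "b \<in> carrier (?Q g)"
    then show "v i \<otimes>\<^bsub>S\<^esub> (a \<otimes>\<^bsub>S\<^esub> b) = (v i \<otimes>\<^bsub>S\<^esub> a) \<odot>\<^bsub>?Q g\<^esub> b"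
      using a v[OF i, THEN closed] closed by (simp add: Q ops S_m_ac(1))
  next
    fix a assume "a \<in> carrier (?Q f)"
    then have a: "a \<in> eigenspace f" by (simp add: Q)
    have "(\<Oplus>\<^bsub>?Q f\<^esub>i\<in>{1..m}. (v i \<otimes>\<^bsub>S\<^esub> a) \<odot>\<^bsub>?Q f\<^esub> u i) = (\<Oplus>\<^bsub>S\<^esub>i\<in>{1..m}. (v i \<otimes>\<^bsub>S\<^esub> a) \<odot>\<^bsub>?Q f\<^esub> u i)"
      using u va[OF _ a] pairing.M.smult_closed
      by (intro finsum_Q_module pairing.M.abelian_group_axioms) (auto simp: Q R closed)
    also have "\<dots> = (\<Oplus>\<^bsub>S\<^esub>i\<in>{1..m}. u i \<otimes>\<^bsub>S\<^esub> (v i \<otimes>\<^bsub>S\<^esub> a))"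
      using a u[THEN closed] v[THEN closed] closed
      by (intro M.finsum_cong') (auto simp: ops m_comm)
    also have "\<dots> = a" by (rule expand[OF closed[OF a]])
    finally show "(\<Oplus>\<^bsub>?Q f\<^esub>i\<in>{1..m}. (v i \<otimes>\<^bsub>S\<^esub> a) \<odot>\<^bsub>?Q f\<^esub> u i) = a" .
  next
    fix c assume "c \<in> carrier (?Q fg)"
    then have c: "c \<in> eigenspace fg" by (simp add: Q)
    have "(\<Oplus>\<^bsub>?Q fg\<^esub>i\<in>{1..m}. u i \<otimes>\<^bsub>S\<^esub> (v i \<otimes>\<^bsub>S\<^esub> c)) = (\<Oplus>\<^bsub>S\<^esub>i\<in>{1..m}. u i \<otimes>\<^bsub>S\<^esub> (v i \<otimes>\<^bsub>S\<^esub> c))"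
      using u vc[OF _ c] pairing.pairing_closed
      by (intro finsum_Q_module pairing.P.abelian_group_axioms) (auto simp: Q closed)
    also have "\<dots> = c" by (rule expand[OF closed[OF c]])
    finally show "(\<Oplus>\<^bsub>?Q fg\<^esub>i\<in>{1..m}. u i \<otimes>\<^bsub>S\<^esub> (v i \<otimes>\<^bsub>S\<^esub> c)) = c" .
  next
    fix a b assume "a \<in> carrier (?Q f)" "b \<in> carrier (?Q g)"
    then show "\<psi> (pure_tensor (S\<lparr>carrier := R\<rparr>) (?Q f) (?Q g) a b) = a \<otimes>\<^bsub>S\<^esub> b"
      by (rule \<psi>_pure)
  qed
qed

end

theorem theorem3p11:
  fixes k :: "('k, 'a) ring_scheme"
    and S :: "('k, 's, 'b) module_scheme"
    and G :: "('g, 'c) monoid_scheme"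
    and D :: "'g \<Rightarrow> 's set"
    and e :: "'g \<Rightarrow> 's"
    and \<alpha> :: "'g \<Rightarrow> 's \<Rightarrow> 's"
    and R :: "'s set"
    and w :: 's
    and f g :: "'g \<Rightarrow> 's"
  defines "R' \<equiv> S\<lparr>carrier := R\<rparr>"
    and "Z \<equiv> Z1 S G D e \<alpha>"
    and "Q \<equiv> Q_module S G D e \<alpha> w"
  assumes "comm_group G"
    and "finite (carrier G)"
    and "partial_galois_extension k S G D e \<alpha> R"
    and "w \<in> carrier S"
    and "(\<Oplus>\<^bsub>S\<^esub>h\<in>carrier G. \<alpha> h (w \<otimes>\<^bsub>S\<^esub> e (inv\<^bsub>G\<^esub> h))) = \<one>\<^bsub>S\<^esub>"
    and "f \<in> carrier Z"
    and "g \<in> carrier Z"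
  shows "(\<exists>!\<psi>. \<psi> \<in> extensional (carrier (tensor_product R' (Q f) (Q g))) \<and>
            \<psi> \<in> mod_hom R' (tensor_product R' (Q f) (Q g)) (Q (f \<otimes>\<^bsub>Z\<^esub> g)) \<and>
            (\<forall>a\<in>carrier (Q f). \<forall>b\<in>carrier (Q g).
               \<psi> (pure_tensor R' (Q f) (Q g) a b) = a \<otimes>\<^bsub>S\<^esub> b)) \<and>
         (\<forall>\<psi> \<in> mod_hom R' (tensor_product R' (Q f) (Q g)) (Q (f \<otimes>\<^bsub>Z\<^esub> g)).
            (\<forall>a\<in>carrier (Q f). \<forall>b\<in>carrier (Q g).
               \<psi> (pure_tensor R' (Q f) (Q g) a b) = a \<otimes>\<^bsub>S\<^esub> b) \<longrightarrow>
            \<psi> \<in> mod_iso R' (tensor_product R' (Q f) (Q g)) (Q (f \<otimes>\<^bsub>Z\<^esub> g)))"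
proof -
  interpret partial_galois_extension k S G D e \<alpha> R by fact
  note fin = \<open>finite (carrier G)\<close> and w = \<open>w \<in> carrier S\<close>
  have w_trace: "(\<Oplus>\<^bsub>S\<^esub>h\<in>carrier G. act h w) = \<one>\<^bsub>S\<^esub>"
    using assms(8) by (simp add: act_def)
  obtain f' g' where f: "inverse_cocycles f f'" and g: "inverse_cocycles g g'"
    using assms(9,10) unfolding Z_def Z1_iff_inverse_cocycles by blast
  define fg where "fg = f \<otimes>\<^bsub>Z\<^esub> g"
  have fg_eq: "fg = (\<lambda>h\<in>carrier G. f h \<otimes>\<^bsub>S\<^esub> g h)"
    by (simp add: fg_def Z_def Z1_def)
  have fg: "inverse_cocycles fg (\<lambda>h. f' h \<otimes>\<^bsub>S\<^esub> g' h)"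
    unfolding fg_eq by (rule inverse_cocycles_mult[OF f g])
  have fg_apply: "fg h = f h \<otimes>\<^bsub>S\<^esub> g h" if "h \<in> carrier G" for h
    using that by (simp add: fg_eq)
  interpret pairing: bilinear_pairing R' "Q f" "Q g" "Q fg" "monoid.mult S"
    unfolding R'_def Q_def by (rule Q_module_pairing[OF fin w w_trace f g fg fg_apply])
  let ?T = "tensor_product R' (Q f) (Q g)"
  obtain \<psi> where \<psi>: "\<psi> \<in> mod_hom R' ?T (Q fg)"
    and \<psi>_pure: "\<And>a b. \<lbrakk>a \<in> carrier (Q f); b \<in> carrier (Q g)\<rbrakk>
      \<Longrightarrow> \<psi> (pure_tensor R' (Q f) (Q g) a b) = a \<otimes>\<^bsub>S\<^esub> b"
    by (rule pairing.tensor_universal_property) blast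
  define \<psi>0 where "\<psi>0 = restrict \<psi> (carrier ?T)"
  have closed: "pure_tensor R' (Q f) (Q g) a b \<in> carrier ?T" if "a \<in> carrier (Q f)" "b \<in> carrier (Q g)" for a b
    using that by (simp add: pairing.pure_tensor_closed)
  have \<psi>0: "\<psi>0 \<in> mod_hom R' ?T (Q fg)"
    using \<psi> pairing.tensor_add_closed pairing.tensor_smult_closed by (auto simp: mod_hom_def \<psi>0_def)
  have "\<exists>!\<psi>. \<psi> \<in> extensional (carrier ?T) \<and> \<psi> \<in> mod_hom R' ?T (Q fg) \<and>
      (\<forall>a\<in>carrier (Q f). \<forall>b\<in>carrier (Q g). \<psi> (pure_tensor R' (Q f) (Q g) a b) = a \<otimes>\<^bsub>S\<^esub> b)"
  proof (rule ex1I[of _ \<psi>0])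
    show "\<psi>0 \<in> extensional (carrier ?T) \<and> \<psi>0 \<in> mod_hom R' ?T (Q fg) \<and>
      (\<forall>a\<in>carrier (Q f). \<forall>b\<in>carrier (Q g). \<psi>0 (pure_tensor R' (Q f) (Q g) a b) = a \<otimes>\<^bsub>S\<^esub> b)"
      using \<psi>0 \<psi>_pure closed by (simp add: \<psi>0_def)
  next
    fix \<phi>
    assume \<phi>: "\<phi> \<in> extensional (carrier ?T) \<and> \<phi> \<in> mod_hom R' ?T (Q fg) \<and>
      (\<forall>a\<in>carrier (Q f). \<forall>b\<in>carrier (Q g). \<phi> (pure_tensor R' (Q f) (Q g) a b) = a \<otimes>\<^bsub>S\<^esub> b)"
    show "\<phi> = \<psi>0"
    proof (rule extensionalityI[of _ "carrier ?T"])
      fix C assume C: "C \<in> carrier ?T"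
      show "\<phi> C = \<psi>0 C"
      proof (rule pairing.mod_hom_tensor_eqI[OF pairing.P.module_axioms _ \<psi>0 _ C])
        show "\<phi> \<in> mod_hom R' ?T (Q fg)" using \<phi> by blast
        fix a b assume "a \<in> carrier (Q f)" "b \<in> carrier (Q g)"
        then show "\<phi> (pure_tensor R' (Q f) (Q g) a b) = \<psi>0 (pure_tensor R' (Q f) (Q g) a b)"
          using \<phi> \<psi>_pure closed by (simp add: \<psi>0_def)
      qed
    next
      show "\<phi> \<in> extensional (carrier ?T)" using \<phi> by blast
      show "\<psi>0 \<in> extensional (carrier ?T)" by (simp add: \<psi>0_def)
    qed
  qed
  moreover have "\<phi> \<in> mod_iso R' ?T (Q fg)"
    if "\<phi> \<in> mod_hom R' ?T (Q fg)"
      "\<forall>a\<in>carrier (Q f). \<forall>b\<in>carrier (Q g). \<phi> (pure_tensor R' (Q f) (Q g) a b) = a \<otimes>\<^bsub>S\<^esub> b" for \<phi>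
    using that unfolding R'_def Q_def
    by (intro Q_module_tensor_iso[OF fin w w_trace f g fg fg_apply]) auto
  ultimately show ?thesis unfolding fg_def by blast
qed

end
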